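(* Let $U\subset\mathbb{D}$ be open and let $\phi:U\to\mathbb{F}$ be a Puiseux-Lojasiewicz bounded function. If the derivative $\phi'(\alpha)$ exists at every $\alpha\in U$, then all derivatives $\phi^{(k)}(\alpha)$, $k\ge 0$, $\alpha\in U$, exist, and for every $\alpha\in U$, every $\delta\in\mathbb{D}$, $\delta\neq 0$, and every sufficiently small contour $C$ around $0\in\mathbb{C}$, $$\oint_{z\in C}\phi(\mu)\,d\mu=0,\qquad \phi^{(k)}(\alpha)=\frac{k!}{2\pi\sqrt{-1}}\oint_{z\in C}\frac{\phi(\mu)}{(\mu-\alpha)^{k+1}}\,d\mu,\quad k\ge 0,$$ where $\mu:=\alpha+z\delta$ and $d\mu:=\delta\,dz$. Moreover $\phi$ is $\mathbb{F}$-analytic in the following sense: if $\alpha+z\delta\in U$ for all $z\in\mathbb{C}$ with $|z|<r$, then $$\phi(\alpha+z\delta)=\phi(\alpha)+\cdots+\frac{1}{k!}\phi^{(k)}(\alpha)(z\delta)^k+\cdots,\qquad |z|<r,$$ where $m_{puis}(\phi^{(k)}(\alpha))\le K(\alpha)$ for all $k$, with $K(\alpha)$ a constant (independent of $k$).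
   Context: $\mathbb{F}$ is the Newton-Puiseux field of convergent fractional power series in an indeterminate $y$: a non-zero element is a (finite or infinite) convergent series $\alpha(y)=a_0y^{n_0/N}+a_1y^{n_1/N}+\cdots$, with $N\in\mathbb{Z}^+$, $n_i\in\mathbb{Z}$, $n_0<n_1<\cdots$, $0\ne a_i\in\mathbb{C}$, normalized by $\gcd(N,n_0,n_1,\dots)=1$. The order is $O_y(\alpha):=n_0/N$, $O_y(0):=+\infty$; the Puiseux multiplicity is $m_{puis}(\alpha):=N$. Let $\mathbb{D}:=\{\alpha\in\mathbb{F}: O_y(\alpha)\ge 0\}$. Put $|\alpha|:=\sum 2^{-n_i/N}|a_i|(1+|a_i|)^{-1}$; $d(\alpha,\beta):=|\alpha-\beta|$ is a metric on $\mathbb{D}$ (limits in $\mathbb{F}$ are taken with the same formula). A function $\phi:U\to\mathbb{F}$ ($U\subset\mathbb{D}$ open) is Puiseux-Lojasiewicz bounded if every $\alpha\in U$ has a neighbourhood $\mathcal{N}(\alpha)$ and constants $K(\alpha),L(\alpha)>0$ such that $m_{puis}(\phi(\xi))\le K(\alpha)m_{puis}(\xi)$ and $O_y(\phi(\xi))\ge -L(\alpha)$ for $\xi\in\mathcal{N}(\alpha)$. $\phi$ is differentiable at $\alpha\in U$ with derivative $\phi'(\alpha)\in\mathbb{F}$ if $\phi'(\alpha)=\lim[\phi(\alpha+\delta)-\phi(\alpha)]/\delta$ as $\delta\to 0$, $\delta\in\mathbb{D}$. Higher derivatives $\phi^{(k)}$ are defined by iteration, $\phi^{(0)}=\phi$.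 For fixed $\alpha,\delta$, the element $\phi(\alpha+z\delta)$ is, for small $z\in\mathbb{C}$, a fractional power series in $y$ with bounded denominators and coefficients depending on $z$; contour integrals over $z\in C$ are taken coefficientwise. *)

theory Defs
  imports "HOL-Complex_Analysis.Complex_Analysis"
begin

unbundle fps_syntax

section \<open>The Newton--Puiseux field of convergent fractional power series\<close>

text \<open>
  A fractional power series is represented by its coefficient function on the rational exponents.
  \<open>frac_fls N f\<close> is the coefficient function of \<open>f(y\<^bsup>1/N\<^esup>)\<close>, for a Laurent series \<open>f\<close>.
\<close>

definition frac_fls :: "nat \<Rightarrow> complex fls \<Rightarrow> rat \<Rightarrow> complex" where
  "frac_fls N f q = (if q * of_nat N \<in> \<int> then f $$ \<lfloor>q * of_nat N\<rfloor> else 0)"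

typedef puiseux = "{frac_fls N f | N f. N > 0 \<and> fls_conv_radius f > 0}"
  morphisms puiseux_coeff Abs_puiseux
  by (rule exI[of _ "frac_fls 1 0"]) force

lemma puiseux_eqI: "(\<And>q. puiseux_coeff a q = puiseux_coeff b q) \<Longrightarrow> a = b"
  by (metis puiseux_coeff_inject ext)

subsection \<open>Reduction to Laurent series with a common denominator\<close>

lemma frac_fls_of_int_divide:
  "N > 0 \<Longrightarrow> frac_fls N f (of_int i / of_nat N) = f $$ i"
  by (simp add: frac_fls_def)

lemma frac_fls_nonzeroE:
  assumes "frac_fls N f q \<noteq> 0" "N > 0"
  obtains i where "q = of_int i / of_nat N" "f $$ i \<noteq> 0"
proof -
  from assms have "q * of_nat N \<in> \<int>" by (auto simp: frac_fls_def split: if_splits)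
  then obtain i where i: "q * of_nat N = of_int i" by (auto elim: Ints_cases)
  then have "q = of_int i / of_nat N" using assms by (simp add: field_simps)
  with assms show ?thesis by (intro that[of i]) (auto simp: frac_fls_of_int_divide)
qed

lemma frac_fls_eqI:
  assumes "N > 0" "\<And>i. h (of_int i / of_nat N) = f $$ i"
    and "\<And>q. q * of_nat N \<notin> \<int> \<Longrightarrow> h q = 0"
  shows "h = frac_fls N f"
proof
  fix q
  show "h q = frac_fls N f q"
  proof (cases "q * of_nat N \<in> \<int>")
    case True
    then obtain i where i: "q * of_nat N = of_int i" by (auto elim: Ints_cases)
    then have "q = of_int i / of_nat N" using assms by (simp add: field_simps)
    with assms show ?thesis by (simp add: frac_fls_of_int_divide)
  next
    case False
    with assms show ?thesis by (simp add: frac_fls_def)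
  qed
qed

lemma frac_fls_inject:
  assumes "N > 0"
  shows "frac_fls N f = frac_fls N g \<longleftrightarrow> f = g"
proof
  assume "frac_fls N f = frac_fls N g"
  then have "f $$ i = g $$ i" for i
    using frac_fls_of_int_divide[OF assms] by metis
  then show "f = g" by (rule fls_eqI)
qed auto

lemma frac_fls_compose_power:
  assumes "N > 0" "d > 0"
  shows "frac_fls N f = frac_fls (N * d) (fls_compose_power f d)"
proof (rule frac_fls_eqI)
  show "N * d > 0" using assms by simp
  show "frac_fls N f q = 0" if "q * of_nat (N * d) \<notin> \<int>" for q
  proof -
    have "q * of_nat N \<notin> \<int>"
    proof
      assume "q * of_nat N \<in> \<int>"
      then have "q * of_nat N * of_nat d \<in> \<int>" by (rule Ints_mult) (rule Ints_of_nat)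
      with that show False by (simp add: mult_ac)
    qed
    then show ?thesis by (simp add: frac_fls_def)
  qed
  fix i :: int
  show "frac_fls N f (of_int i / of_nat (N * d)) = fls_compose_power f d $$ i"
  proof (cases "int d dvd i")
    case True
    then obtain k where k: "i = int d * k" by auto
    have "(of_int i / of_nat (N * d) :: rat) = of_int k / of_nat N"
      using assms by (simp add: k)
    with assms k show ?thesis by (simp add: frac_fls_of_int_divide fls_nth_compose_power)
  next
    case False
    have "of_int i / of_nat (N * d) * of_nat N \<notin> (\<int> :: rat set)"
    proof
      assume "of_int i / of_nat (N * d) * of_nat N \<in> (\<int> :: rat set)"
      then obtain k where "of_int i / of_nat (N * d) * of_nat N = (of_int k :: rat)"
        by (auto elim: Ints_cases)
      then have "(of_int i :: rat) = of_int (k * int d)"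
        using assms by (simp add: field_simps)
      then have "i = k * int d" by (simp only: of_int_eq_iff)
      with False show False by simp
    qed
    with False assms show ?thesis by (simp add: frac_fls_def fls_nth_compose_power)
  qed
qed

lemma fls_conv_radius_pos_iff:
  "fls_conv_radius f > 0 \<longleftrightarrow> (\<exists>C R. \<forall>n. norm (f $$ int n) \<le> C * R ^ n)"
proof
  assume "fls_conv_radius f > 0"
  then obtain r where r: "0 < ereal r" "ereal r < fls_conv_radius f"
    using ereal_dense2 by blast
  then have "summable (\<lambda>n. f $$ int n * complex_of_real r ^ n)"
    by (intro summable_in_conv_radius) (auto simp: fls_conv_radius_def fps_conv_radius_def)
  then have "Bseq (\<lambda>n. f $$ int n * complex_of_real r ^ n)"
    by (intro convergent_imp_Bseq) (use convergentI summable_LIMSEQ_zero in blast)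
  then obtain C where C: "\<And>n. norm (f $$ int n * complex_of_real r ^ n) \<le> C"
    unfolding Bseq_def by blast
  show "\<exists>C R. \<forall>n. norm (f $$ int n) \<le> C * R ^ n"
  proof (intro exI allI)
    fix n
    show "norm (f $$ int n) \<le> C * (1 / r) ^ n"
      using C[of n] r by (simp add: norm_mult norm_power field_simps)
  qed
next
  assume "\<exists>C R. \<forall>n. norm (f $$ int n) \<le> C * R ^ n"
  then obtain C R where CR: "\<And>n. norm (f $$ int n) \<le> C * R ^ n" by blast
  define S where "S = \<bar>R\<bar> + 1"
  have S: "S > 0" by (simp add: S_def)
  have "C \<ge> 0" using order_trans[OF norm_ge_zero CR[of 0]] by simp
  have CS: "norm (f $$ int n) \<le> C * S ^ n" for n
  proof -
    have "R ^ n \<le> \<bar>R\<bar> ^ n" by (metis abs_ge_self power_abs)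
    also have "\<dots> \<le> S ^ n" by (intro power_mono) (auto simp: S_def)
    finally show ?thesis using CR[of n] \<open>C \<ge> 0\<close> by (meson mult_left_mono order_trans)
  qed
  have "conv_radius (\<lambda>n. f $$ int n) \<ge> norm (complex_of_real (1 / (2 * S)))"
  proof (rule conv_radius_geI)
    show "summable (\<lambda>n. f $$ int n * complex_of_real (1 / (2 * S)) ^ n)"
    proof (rule summable_comparison_test')
      show "summable (\<lambda>n. C * (1 / 2) ^ n :: real)"
        by (intro summable_mult summable_geometric) auto
      fix n
      have "norm (f $$ int n * complex_of_real (1 / (2 * S)) ^ n)
              = norm (f $$ int n) * (1 / (2 * S)) ^ n"
        using S by (simp add: norm_mult norm_power norm_divide)
      also have "\<dots> \<le> C * S ^ n * (1 / (2 * S)) ^ n"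
        using CS[of n] S by (intro mult_right_mono) auto
      also have "\<dots> = C * (1 / 2) ^ n"
        using S by (simp add: power_divide power_mult_distrib)
      finally show "norm (f $$ int n * complex_of_real (1 / (2 * S)) ^ n) \<le> C * (1 / 2) ^ n" .
    qed
  qed
  moreover have "0 < ereal (norm (complex_of_real (1 / (2 * S))))" using S by simp
  moreover have "fls_conv_radius f = conv_radius (\<lambda>n. f $$ int n)"
    by (simp add: fls_conv_radius_def fps_conv_radius_def)
  ultimately show "fls_conv_radius f > 0" by (metis order.strict_trans2)
qed

lemma fls_conv_radius_compose_power_pos:
  assumes "fls_conv_radius f > 0" "d > 0"
  shows "fls_conv_radius (fls_compose_power f d) > 0"
proof -
  obtain C R where CR: "\<And>n. norm (f $$ int n) \<le> C * R ^ n"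
    using assms(1) by (auto simp: fls_conv_radius_pos_iff)
  have C: "C \<ge> 0" using order_trans[OF norm_ge_zero CR[of 0]] by simp
  have "norm (fls_compose_power f d $$ int n) \<le> C * (\<bar>R\<bar> + 1) ^ n" for n
  proof (cases "d dvd n")
    case True
    then obtain k where k: "n = d * k" by auto
    have "R ^ k \<le> \<bar>R\<bar> ^ k" by (metis abs_ge_self power_abs)
    then have "norm (f $$ int k) \<le> C * \<bar>R\<bar> ^ k"
      using CR[of k] C by (meson mult_left_mono order_trans)
    also have "\<dots> \<le> C * (\<bar>R\<bar> + 1) ^ k" using C by (intro mult_left_mono power_mono) auto
    also have "\<dots> \<le> C * (\<bar>R\<bar> + 1) ^ n"
      using C assms(2) by (intro mult_left_mono power_increasing) (auto simp: k)
    finally show ?thesis using assms(2) by (simp add: k fls_nth_compose_power)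
  next
    case False
    then show ?thesis using C assms(2) by (simp add: fls_nth_compose_power)
  qed
  then show ?thesis unfolding fls_conv_radius_pos_iff by blast
qed

lemma fls_conv_radius_inverse_pos:
  assumes "fls_conv_radius f > 0"
  shows "fls_conv_radius (inverse f) > 0"
proof -
  have "eval_fls f has_laurent_expansion f"
    using assms by (auto simp: has_laurent_expansion_def)
  then have "(\<lambda>z. inverse (eval_fls f z)) has_laurent_expansion inverse f"
    by (rule has_laurent_expansion_inverse)
  then show ?thesis by (simp add: has_laurent_expansion_def)
qed

lemma fls_conv_radius_add_pos:
  "fls_conv_radius f > 0 \<Longrightarrow> fls_conv_radius g > 0 \<Longrightarrow> fls_conv_radius (f + g) > 0"
  using fls_conv_radius_add[of f g] by (simp add: min_def split: if_splits)

lemma fls_conv_radius_mult_pos: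
  "fls_conv_radius f > 0 \<Longrightarrow> fls_conv_radius g > 0 \<Longrightarrow> fls_conv_radius (f * g) > 0"
  using fls_conv_radius_mult[of f g] by (simp add: min_def split: if_splits)

definition puiseux_of_fls :: "nat \<Rightarrow> complex fls \<Rightarrow> puiseux" where
  "puiseux_of_fls N f = Abs_puiseux (frac_fls N f)"

lemma coeff_puiseux_of_fls:
  "N > 0 \<Longrightarrow> fls_conv_radius f > 0 \<Longrightarrow> puiseux_coeff (puiseux_of_fls N f) = frac_fls N f"
  unfolding puiseux_of_fls_def by (subst Abs_puiseux_inverse) auto

lemma puiseux_of_fls_eqI:
  "N > 0 \<Longrightarrow> fls_conv_radius f > 0 \<Longrightarrow> puiseux_coeff a = frac_fls N f \<Longrightarrow> a = puiseux_of_fls N f"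
  by (simp add: puiseux_eqI coeff_puiseux_of_fls)

lemma puiseux_of_fls_inject:
  assumes "N > 0" "fls_conv_radius f > 0" "fls_conv_radius g > 0"
  shows "puiseux_of_fls N f = puiseux_of_fls N g \<longleftrightarrow> f = g"
  using assms by (metis coeff_puiseux_of_fls frac_fls_inject)

lemma puiseux_of_fls_refine:
  assumes "N > 0" "d > 0"
  shows "puiseux_of_fls N f = puiseux_of_fls (N * d) (fls_compose_power f d)"
  unfolding puiseux_of_fls_def by (simp add: frac_fls_compose_power[OF assms])

lemma puiseux_cases:
  obtains N f where "N > 0" "fls_conv_radius f > 0" "a = puiseux_of_fls N f"
proof -
  obtain N f where "N > 0" "fls_conv_radius f > 0" "puiseux_coeff a = frac_fls N f"
    using puiseux_coeff[of a] by blast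
  then show ?thesis by (intro that[of N f] puiseux_of_fls_eqI)
qed

lemma puiseux_cases2:
  obtains N f g where "N > 0" "fls_conv_radius f > 0" "fls_conv_radius g > 0"
    "a = puiseux_of_fls N f" "b = puiseux_of_fls N g"
proof -
  obtain M f where f: "M > 0" "fls_conv_radius f > 0" "a = puiseux_of_fls M f"
    by (rule puiseux_cases)
  obtain K g where g: "K > 0" "fls_conv_radius g > 0" "b = puiseux_of_fls K g"
    by (rule puiseux_cases)
  show ?thesis
  proof (rule that[of "M * K" "fls_compose_power f K" "fls_compose_power g M"])
    show "a = puiseux_of_fls (M * K) (fls_compose_power f K)"
      using f g puiseux_of_fls_refine by metis
    show "b = puiseux_of_fls (M * K) (fls_compose_power g M)"
      using f g puiseux_of_fls_refine by (metis mult.commute)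
  qed (use f g in \<open>auto intro: fls_conv_radius_compose_power_pos\<close>)
qed

lemma puiseux_cases3:
  obtains N f g h where "N > 0" "fls_conv_radius f > 0" "fls_conv_radius g > 0"
    "fls_conv_radius h > 0"
    "a = puiseux_of_fls N f" "b = puiseux_of_fls N g" "c = puiseux_of_fls N h"
proof -
  obtain M f g where f: "M > 0" "fls_conv_radius f > 0" "fls_conv_radius g > 0"
    "a = puiseux_of_fls M f" "b = puiseux_of_fls M g"
    by (rule puiseux_cases2)
  obtain K h where h: "K > 0" "fls_conv_radius h > 0" "c = puiseux_of_fls K h"
    by (rule puiseux_cases)
  show ?thesis
  proof (rule that[of "M * K" "fls_compose_power f K" "fls_compose_power g K"
                      "fls_compose_power h M"])
    show "a = puiseux_of_fls (M * K) (fls_compose_power f K)"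
      using f h puiseux_of_fls_refine by metis
    show "b = puiseux_of_fls (M * K) (fls_compose_power g K)"
      using f h puiseux_of_fls_refine by metis
    show "c = puiseux_of_fls (M * K) (fls_compose_power h M)"
      using f h puiseux_of_fls_refine by (metis mult.commute)
  qed (use f h in \<open>auto intro: fls_conv_radius_compose_power_pos\<close>)
qed

subsection \<open>Field operations\<close>

definition puiseux_const :: "complex \<Rightarrow> puiseux" where
  "puiseux_const c = Abs_puiseux (\<lambda>q. if q = 0 then c else 0)"

lemma frac_fls_const:
  "N > 0 \<Longrightarrow> (\<lambda>q. if q = 0 then c else 0) = frac_fls N (fls_const c)"
  by (rule frac_fls_eqI) auto

lemma puiseux_const_of_fls: "N > 0 \<Longrightarrow> puiseux_const c = puiseux_of_fls N (fls_const c)"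
  by (simp add: puiseux_const_def puiseux_of_fls_def frac_fls_const)

lemma coeff_puiseux_const: "puiseux_coeff (puiseux_const c) q = (if q = 0 then c else 0)"
proof -
  have "puiseux_coeff (puiseux_const c) = frac_fls 1 (fls_const c)"
    by (subst puiseux_const_of_fls[of 1], simp, subst coeff_puiseux_of_fls) auto
  then show ?thesis by (simp only: frac_fls_const[of 1 c, OF zero_less_one, symmetric])
qed

instantiation puiseux :: "{zero, one, plus, minus, uminus, times, inverse}"
begin

definition zero_puiseux :: puiseux where "0 = puiseux_const 0"

definition one_puiseux :: puiseux where "1 = puiseux_const 1"

definition plus_puiseux :: "puiseux \<Rightarrow> puiseux \<Rightarrow> puiseux" where
  "a + b = Abs_puiseux (\<lambda>q. puiseux_coeff a q + puiseux_coeff b q)"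

definition uminus_puiseux :: "puiseux \<Rightarrow> puiseux" where
  "- a = Abs_puiseux (\<lambda>q. - puiseux_coeff a q)"

definition minus_puiseux :: "puiseux \<Rightarrow> puiseux \<Rightarrow> puiseux" where
  "a - b = Abs_puiseux (\<lambda>q. puiseux_coeff a q - puiseux_coeff b q)"

definition times_puiseux :: "puiseux \<Rightarrow> puiseux \<Rightarrow> puiseux" where
  "a * b = Abs_puiseux (\<lambda>q. \<Sum>p | puiseux_coeff a p \<noteq> 0 \<and> puiseux_coeff b (q - p) \<noteq> 0.
                               puiseux_coeff a p * puiseux_coeff b (q - p))"

definition inverse_puiseux :: "puiseux \<Rightarrow> puiseux" where
  "inverse a = (if a = 0 then 0 else THE b. a * b = 1)" for a :: puiseux

definition divide_puiseux :: "puiseux \<Rightarrow> puiseux \<Rightarrow> puiseux" where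
  "a div b = a * inverse b" for a b :: puiseux

instance ..

end

lemma zero_puiseux_of_fls: "N > 0 \<Longrightarrow> 0 = puiseux_of_fls N 0"
  by (simp add: zero_puiseux_def puiseux_const_of_fls)

lemma one_puiseux_of_fls: "N > 0 \<Longrightarrow> 1 = puiseux_of_fls N 1"
  by (simp add: one_puiseux_def puiseux_const_of_fls)

lemma plus_puiseux_of_fls:
  assumes "N > 0" "fls_conv_radius f > 0" "fls_conv_radius g > 0"
  shows "puiseux_of_fls N f + puiseux_of_fls N g = puiseux_of_fls N (f + g)"
proof -
  have "(\<lambda>q. frac_fls N f q + frac_fls N g q) = frac_fls N (f + g)"
    by (auto simp: frac_fls_def)
  then show ?thesis
    using assms by (simp add: plus_puiseux_def coeff_puiseux_of_fls puiseux_of_fls_def[of N "f + g"])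
qed

lemma minus_puiseux_of_fls:
  assumes "N > 0" "fls_conv_radius f > 0" "fls_conv_radius g > 0"
  shows "puiseux_of_fls N f - puiseux_of_fls N g = puiseux_of_fls N (f - g)"
proof -
  have "(\<lambda>q. frac_fls N f q - frac_fls N g q) = frac_fls N (f - g)"
    by (auto simp: frac_fls_def)
  then show ?thesis
    using assms by (simp add: minus_puiseux_def coeff_puiseux_of_fls puiseux_of_fls_def[of N "f - g"])
qed

lemma uminus_puiseux_of_fls:
  assumes "N > 0" "fls_conv_radius f > 0"
  shows "- puiseux_of_fls N f = puiseux_of_fls N (- f)"
proof -
  have "(\<lambda>q. - frac_fls N f q) = frac_fls N (- f)"
    by (auto simp: frac_fls_def)
  then show ?thesis
    using assms by (simp add: uminus_puiseux_def coeff_puiseux_of_fls puiseux_of_fls_def[of N "- f"])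
qed

lemma times_puiseux_of_fls:
  assumes N: "N > 0" and "fls_conv_radius f > 0" "fls_conv_radius g > 0"
  shows "puiseux_of_fls N f * puiseux_of_fls N g = puiseux_of_fls N (f * g)"
proof -
  let ?S = "\<lambda>q. {p. frac_fls N f p \<noteq> 0 \<and> frac_fls N g (q - p) \<noteq> 0}"
  have "(\<lambda>q. \<Sum>p\<in>?S q. frac_fls N f p * frac_fls N g (q - p)) = frac_fls N (f * g)"
  proof (rule frac_fls_eqI[OF N])
    fix m :: int
    let ?q = "of_int m / of_nat N :: rat" and ?h = "\<lambda>i. of_int i / of_nat N :: rat"
    have g: "frac_fls N g (?q - ?h i) = g $$ (m - i)" for i
    proof -
      have "?q - ?h i = ?h (m - i)" by (simp add: diff_divide_distrib)
      then show ?thesis using frac_fls_of_int_divide[OF N, of g "m - i"] by (simp only:)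
    qed
    have inj: "inj_on ?h A" for A using N by (auto simp: inj_on_def)
    have S: "?S ?q = ?h ` {i. f $$ i \<noteq> 0 \<and> g $$ (m - i) \<noteq> 0}"
    proof (intro equalityI subsetI)
      fix p assume p: "p \<in> ?S ?q"
      then obtain i where i: "p = ?h i" "f $$ i \<noteq> 0"
        using N by (auto elim: frac_fls_nonzeroE)
      with p have "g $$ (m - i) \<noteq> 0"
        using g by auto
      with i show "p \<in> ?h ` {i. f $$ i \<noteq> 0 \<and> g $$ (m - i) \<noteq> 0}" by blast
    qed (use g N in \<open>auto simp: frac_fls_of_int_divide\<close>)
    have "(\<Sum>p\<in>?S ?q. frac_fls N f p * frac_fls N g (?q - p))
            = (\<Sum>i | f $$ i \<noteq> 0 \<and> g $$ (m - i) \<noteq> 0. f $$ i * g $$ (m - i))"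
      unfolding S by (subst sum.reindex[OF inj])
                     (simp add: g frac_fls_of_int_divide[OF N])
    also have "\<dots> = (\<Sum>i = fls_subdegree f..m - fls_subdegree g. f $$ i * g $$ (m - i))"
    proof (rule sum.mono_neutral_left)
      show "{i. f $$ i \<noteq> 0 \<and> g $$ (m - i) \<noteq> 0} \<subseteq> {fls_subdegree f..m - fls_subdegree g}"
        using fls_subdegree_leI by fastforce
    qed auto
    also have "\<dots> = (f * g) $$ m" by (rule fls_times_nth(2)[symmetric])
    finally show "(\<Sum>p\<in>?S ?q. frac_fls N f p * frac_fls N g (?q - p)) = (f * g) $$ m" .
  next
    fix q :: rat assume q: "q * of_nat N \<notin> \<int>"
    have "?S q = {}"
    proof safe
      fix p assume "frac_fls N f p \<noteq> 0" "frac_fls N g (q - p) \<noteq> 0"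
      then have "p * of_nat N \<in> \<int>" "(q - p) * of_nat N \<in> \<int>"
        by (auto simp: frac_fls_def split: if_splits)
      then have "p * of_nat N + (q - p) * of_nat N \<in> \<int>" by (rule Ints_add)
      with q show "p \<in> {}" by (simp add: algebra_simps)
    qed
    then show "(\<Sum>p\<in>?S q. frac_fls N f p * frac_fls N g (q - p)) = 0"
      by (simp only: sum.empty)
  qed
  then show ?thesis
    using assms by (simp add: times_puiseux_def coeff_puiseux_of_fls puiseux_of_fls_def[of N "f * g"])
qed

lemmas puiseux_of_fls_simps =
  plus_puiseux_of_fls minus_puiseux_of_fls uminus_puiseux_of_fls times_puiseux_of_fls
  fls_conv_radius_add_pos fls_conv_radius_mult_pos

lemma coeff_puiseux_zero: "puiseux_coeff 0 q = 0"
  by (simp add: zero_puiseux_def coeff_puiseux_const)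

lemma coeff_puiseux_plus:
  "puiseux_coeff (a + b) q = puiseux_coeff a q + puiseux_coeff b q"
  by (rule puiseux_cases2[of a b])
     (simp add: puiseux_of_fls_simps coeff_puiseux_of_fls, simp add: frac_fls_def)

lemma coeff_puiseux_minus:
  "puiseux_coeff (a - b) q = puiseux_coeff a q - puiseux_coeff b q"
proof -
  obtain N f g where *: "N > 0" "fls_conv_radius f > 0" "fls_conv_radius g > 0"
    "a = puiseux_of_fls N f" "b = puiseux_of_fls N g"
    by (rule puiseux_cases2)
  have "fls_conv_radius (f - g) > 0"
    using fls_conv_radius_add_pos[of f "- g"] * by simp
  with * show ?thesis
    by (simp add: puiseux_of_fls_simps coeff_puiseux_of_fls) (simp add: frac_fls_def)
qed

instance puiseux :: comm_ring_1
proof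
  fix a b c :: puiseux
  obtain N f g h where *: "N > 0" "fls_conv_radius f > 0" "fls_conv_radius g > 0"
    "fls_conv_radius h > 0"
    "a = puiseux_of_fls N f" "b = puiseux_of_fls N g" "c = puiseux_of_fls N h"
    by (rule puiseux_cases3)
  note [simp] = puiseux_of_fls_simps zero_puiseux_of_fls[OF *(1)] one_puiseux_of_fls[OF *(1)]
    puiseux_of_fls_inject
  show "a * b * c = a * (b * c)" using * by (simp add: mult.assoc)
  show "a * b = b * a" using * by (simp add: mult.commute)
  show "1 * a = a" using * by simp
  show "a + b + c = a + (b + c)" using * by (simp add: add.assoc)
  show "a + b = b + a" using * by (simp add: add.commute)
  show "0 + a = a" using * by simp
  show "- a + a = 0" using * by simp
  show "a - b = a + - b" using * by simp
  show "(a + b) * c = a * c + b * c" using * by (simp add: distrib_right)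
  have "puiseux_of_fls N 0 \<noteq> puiseux_of_fls N 1"
    using *(1) by (subst puiseux_of_fls_inject) auto
  then show "(0 :: puiseux) \<noteq> 1" by simp
qed

instance puiseux :: idom
proof
  fix a b :: puiseux
  obtain N f g where *: "N > 0" "fls_conv_radius f > 0" "fls_conv_radius g > 0"
    "a = puiseux_of_fls N f" "b = puiseux_of_fls N g"
    by (rule puiseux_cases2)
  show "a \<noteq> 0 \<Longrightarrow> b \<noteq> 0 \<Longrightarrow> a * b \<noteq> 0"
    using * by (simp add: puiseux_of_fls_simps zero_puiseux_of_fls[OF *(1)] puiseux_of_fls_inject)
qed

instance puiseux :: field
proof
  fix a b :: puiseux
  show "inverse a * a = 1" if "a \<noteq> 0"
  proof -
    obtain N f where *: "N > 0" "fls_conv_radius f > 0" "a = puiseux_of_fls N f"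
      by (rule puiseux_cases)
    with that have "f \<noteq> 0" by (auto simp: zero_puiseux_of_fls)
    with * have ex: "a * puiseux_of_fls N (inverse f) = 1"
      by (simp add: times_puiseux_of_fls fls_conv_radius_inverse_pos one_puiseux_of_fls)
    have "(THE b. a * b = 1) = puiseux_of_fls N (inverse f)"
      by (rule the_equality) (use ex that in \<open>metis mult_cancel_left\<close>)+
    with ex that show ?thesis by (simp add: inverse_puiseux_def mult.commute)
  qed
  show "a / b = a * inverse b" by (rule divide_puiseux_def)
  show "inverse (0 :: puiseux) = 0" by (simp add: inverse_puiseux_def)
qed

lemma coeff_puiseux_of_nat: "puiseux_coeff (of_nat n) q = (if q = 0 then of_nat n else 0)"
  by (induction n)
     (auto simp: coeff_puiseux_zero coeff_puiseux_plus one_puiseux_def coeff_puiseux_const)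

instance puiseux :: field_char_0
proof
  show "inj (of_nat :: nat \<Rightarrow> puiseux)"
  proof (rule injI)
    fix m n assume "(of_nat m :: puiseux) = of_nat n"
    then have "puiseux_coeff (of_nat m) 0 = puiseux_coeff (of_nat n) 0" by simp
    then show "m = n" by (simp add: coeff_puiseux_of_nat)
  qed
qed

subsection \<open>Order and Puiseux multiplicity\<close>

definition puiseux_supp :: "puiseux \<Rightarrow> rat set" where
  "puiseux_supp a = {q. puiseux_coeff a q \<noteq> 0}"

lemma puiseux_supp_subset:
  obtains N :: nat and m :: int
  where "N > 0" "puiseux_supp a \<subseteq> (\<lambda>i. of_int i / of_nat N) ` {m..}"
proof -
  obtain N f where *: "N > 0" "fls_conv_radius f > 0" "a = puiseux_of_fls N f"
    by (rule puiseux_cases)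
  have "puiseux_supp a \<subseteq> (\<lambda>i. of_int i / of_nat N) ` {fls_subdegree f..}"
  proof
    fix q assume "q \<in> puiseux_supp a"
    then have "frac_fls N f q \<noteq> 0" using * by (simp add: puiseux_supp_def coeff_puiseux_of_fls)
    then obtain i where "q = of_int i / of_nat N" "f $$ i \<noteq> 0"
      using *(1) by (rule frac_fls_nonzeroE)
    then show "q \<in> (\<lambda>i. of_int i / of_nat N) ` {fls_subdegree f..}"
      using fls_subdegree_leI by fastforce
  qed
  with *(1) show ?thesis by (rule that)
qed

definition puiseux_order :: "puiseux \<Rightarrow> ereal" where
  "puiseux_order a = (if a = 0 then \<infinity> else ereal (of_rat (LEAST q. q \<in> puiseux_supp a)))"

definition puiseux_denom :: "puiseux \<Rightarrow> nat \<Rightarrow> bool" where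
  "puiseux_denom a N \<longleftrightarrow> N > 0 \<and> (\<forall>q\<in>puiseux_supp a. q * of_nat N \<in> \<int>) \<and>
     Gcd (insert (int N) {n. of_int n / of_nat N \<in> puiseux_supp a}) = 1"

lemma puiseux_denom_ex1: "\<exists>!N. puiseux_denom a N"
proof (rule ex_ex1I)
  let ?P = "\<lambda>N :: nat. N > 0 \<and> (\<forall>q\<in>puiseux_supp a. q * of_nat N \<in> \<int>)"
  obtain N0 m where N0: "N0 > 0" "puiseux_supp a \<subseteq> (\<lambda>i. of_int i / of_nat N0) ` {m..}"
    by (rule puiseux_supp_subset)
  then have "?P N0" by auto
  define N where "N = (LEAST N. ?P N)"
  have P: "?P N" unfolding N_def by (rule LeastI) (rule \<open>?P N0\<close>)
  let ?S = "insert (int N) {n. of_int n / of_nat N \<in> puiseux_supp a}"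
  define d where "d = nat (Gcd ?S)"
  have d_dvd: "int d dvd n" if "n \<in> ?S" for n
    unfolding d_def using Gcd_dvd[OF that] by (simp del: Gcd_insert)
  have "d dvd N" using d_dvd[of "int N"] by simp
  then obtain M where M: "N = d * M" by auto
  have pos: "d > 0" "M > 0" using P M by (auto intro: Nat.gr0I)
  have "?P M"
  proof (intro conjI ballI)
    fix q assume q: "q \<in> puiseux_supp a"
    with P obtain n where n: "q * of_nat N = of_int n" by (auto elim: Ints_cases)
    then have qn: "q = of_int n / of_nat N" using P by (simp add: field_simps)
    with q have "int d dvd n" by (intro d_dvd) auto
    then obtain k where "n = int d * k" by auto
    with qn have "q = of_int k / of_nat M" using pos by (simp add: M)
    then show "q * of_nat M \<in> \<int>" using pos by simp
  qed (use pos in auto)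
  then have "N \<le> M" unfolding N_def by (rule Least_le)
  with M pos have "d = 1"
    by (metis One_nat_def Suc_leI le_antisym mult.left_neutral mult_le_cancel2)
  then have "Gcd ?S = 1" by (simp add: d_def)
  with P show "\<exists>N. puiseux_denom a N" unfolding puiseux_denom_def by blast
next
  have dvd: "M dvd N" if M: "puiseux_denom a M" and N: "puiseux_denom a N" for M N
  proof -
    let ?S = "insert (int M) {n. of_int n / of_nat M \<in> puiseux_supp a}"
    have "int M dvd n * int N" if "n \<in> ?S" for n
    proof (cases "n = int M")
      case False
      with that have "of_int n / of_nat M \<in> puiseux_supp a" by auto
      with N have "of_int n / of_nat M * of_nat N \<in> (\<int> :: rat set)"
        unfolding puiseux_denom_def by blast
      then obtain k where "of_int n / of_nat M * of_nat N = (of_int k :: rat)"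
        by (auto elim: Ints_cases)
      then have "(of_int (n * int N) :: rat) = of_int (int M * k)"
        using M by (simp add: puiseux_denom_def field_simps)
      then have "n * int N = int M * k" by (simp only: of_int_eq_iff)
      then show ?thesis by simp
    qed simp
    then have "int M dvd Gcd ((*) (int N) ` ?S)"
      by (intro Gcd_greatest) (auto simp: mult.commute)
    also have "\<dots> = int N" using M by (simp only: Gcd_mult puiseux_denom_def) simp
    finally show ?thesis by simp
  qed
  show "\<And>M N. puiseux_denom a M \<Longrightarrow> puiseux_denom a N \<Longrightarrow> M = N"
    by (intro dvd_antisym dvd)
qed

text \<open>The normalisation condition gives multiplicity \<open>1\<close> for the zero series.\<close>

definition puiseux_mult :: "puiseux \<Rightarrow> nat" where
  "puiseux_mult a = (THE N. puiseux_denom a N)"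

definition puiseux_valring :: "puiseux set" where
  "puiseux_valring = {a. puiseux_order a \<ge> 0}"

subsection \<open>The metric\<close>

definition puiseux_size :: "puiseux \<Rightarrow> real" where
  "puiseux_size a = (\<Sum>\<^sub>\<infinity>q\<in>puiseux_supp a.
     2 powr (- of_rat q) * (norm (puiseux_coeff a q) / (1 + norm (puiseux_coeff a q))))"

lemma puiseux_size_summable:
  "(\<lambda>q. 2 powr (- of_rat q) * (norm (puiseux_coeff a q) / (1 + norm (puiseux_coeff a q))))
     summable_on A"
proof -
  let ?t = "\<lambda>q. 2 powr (- of_rat q) * (norm (puiseux_coeff a q) / (1 + norm (puiseux_coeff a q)))"
  obtain N :: nat and m :: int
    where N: "N > 0" "puiseux_supp a \<subseteq> (\<lambda>i. of_int i / of_nat N) ` {m..}"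
    by (rule puiseux_supp_subset)
  define h where "h = (\<lambda>k :: nat. of_int (m + int k) / of_nat N :: rat)"
  have inj: "inj h" using N by (auto simp: h_def inj_on_def)
  have sub: "puiseux_supp a \<subseteq> range h"
  proof
    fix q assume "q \<in> puiseux_supp a"
    with N obtain i where "i \<ge> m" "q = of_int i / of_nat N" by auto
    then have "q = h (nat (i - m))" by (simp add: h_def)
    then show "q \<in> range h" by blast
  qed
  define c where "c = 2 powr (- (1 / real N))"
  have c: "0 < c" "c < 1" using N by (auto simp: c_def powr_less_one)
  have bound: "norm (?t (h k)) \<le> 2 powr (- (of_int m / real N)) * c ^ k" for k
  proof -
    have "norm (x :: complex) / (1 + norm x) \<le> 1" for x
      by (rule divide_le_eq_1[THEN iffD2]) (use norm_ge_zero[of x] in linarith)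
    then have *: "norm (?t (h k)) \<le> 2 powr (- of_rat (h k)) * 1"
      unfolding real_norm_def abs_mult by (intro mult_mono) (simp_all add: abs_mult)
    have "- of_rat (h k) = - (of_int m / real N) + real k * (- (1 / real N))"
      by (simp add: h_def of_rat_divide of_rat_add add_divide_distrib)
    then have "2 powr (- of_rat (h k)) = 2 powr (- (of_int m / real N)) * c ^ k"
      by (simp only: powr_add c_def powr_power)
    with * show ?thesis by (simp only: mult_1_right)
  qed
  have "summable (\<lambda>k. norm (?t (h k)))"
  proof (rule summable_comparison_test')
    show "summable (\<lambda>k. 2 powr (- (of_int m / real N)) * c ^ k)"
      using c by (intro summable_mult summable_geometric) auto
  qed (use bound in auto)
  then have "(?t \<circ> h) summable_on UNIV"
    by (intro norm_summable_imp_summable_on) (simp add: o_def)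
  then have "?t summable_on range h" using inj by (simp add: summable_on_reindex)
  then have "?t summable_on UNIV"
    by (rule summable_on_cong_neutral[THEN iffD1, rotated -1])
       (use sub in \<open>auto simp: puiseux_supp_def\<close>)
  then show ?thesis by (rule summable_on_subset_banach) auto
qed

lemma puiseux_size_altdef:
  "puiseux_size a = (\<Sum>\<^sub>\<infinity>q.
     2 powr (- of_rat q) * (norm (puiseux_coeff a q) / (1 + norm (puiseux_coeff a q))))"
  unfolding puiseux_size_def by (rule infsum_cong_neutral) (auto simp: puiseux_supp_def)

lemma puiseux_size_nonneg: "puiseux_size a \<ge> 0"
  unfolding puiseux_size_def by (rule infsum_nonneg) auto

lemma puiseux_size_zero_iff: "puiseux_size a = 0 \<longleftrightarrow> a = 0"
proof
  assume 0: "puiseux_size a = 0"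
  show "a = 0"
  proof (rule puiseux_eqI)
    fix q
    have "2 powr (- of_rat q) * (norm (puiseux_coeff a q) / (1 + norm (puiseux_coeff a q))) = (0 :: real)"
      using 0 puiseux_size_summable[of a UNIV] unfolding puiseux_size_altdef
      by (intro nonneg_infsum_le_0D[where A = UNIV]) auto
    moreover have "1 + norm (puiseux_coeff a q) > 0"
      by (rule add_pos_nonneg) auto
    ultimately show "puiseux_coeff a q = puiseux_coeff 0 q"
      by (auto simp: coeff_puiseux_zero)
  qed
qed (simp add: puiseux_size_altdef coeff_puiseux_zero)

lemma puiseux_size_minus_triangle:
  "puiseux_size (a - b) \<le> puiseux_size a + puiseux_size b"
proof -
  have "norm (x - y) / (1 + norm (x - y)) \<le> norm x / (1 + norm x) + norm y / (1 + norm y)"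
    for x y :: complex
  proof -
    have le: "s / (1 + s) \<le> t / (1 + t)" if "0 \<le> s" "s \<le> t" for s t :: real
      using that by (simp add: field_simps)
    have "norm (x - y) / (1 + norm (x - y)) \<le> (norm x + norm y) / (1 + (norm x + norm y))"
      by (intro le norm_triangle_ineq4) auto
    also have "\<dots> = norm x / (1 + (norm x + norm y)) + norm y / (1 + (norm x + norm y))"
      by (rule add_divide_distrib)
    also have "\<dots> \<le> norm x / (1 + norm x) + norm y / (1 + norm y)"
      by (intro add_mono divide_left_mono mult_pos_pos add_pos_nonneg) auto
    finally show ?thesis .
  qed
  then have "2 powr (- of_rat q) * (norm (puiseux_coeff (a - b) q) / (1 + norm (puiseux_coeff (a - b) q)))
      \<le> 2 powr (- of_rat q) * (norm (puiseux_coeff a q) / (1 + norm (puiseux_coeff a q))) +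
         2 powr (- of_rat q) * (norm (puiseux_coeff b q) / (1 + norm (puiseux_coeff b q)))" for q
    unfolding coeff_puiseux_minus distrib_left[symmetric] by (rule mult_left_mono) simp
  then have "puiseux_size (a - b) \<le> (\<Sum>\<^sub>\<infinity>q.
     2 powr (- of_rat q) * (norm (puiseux_coeff a q) / (1 + norm (puiseux_coeff a q))) +
     2 powr (- of_rat q) * (norm (puiseux_coeff b q) / (1 + norm (puiseux_coeff b q))))"
    unfolding puiseux_size_altdef
    by (intro infsum_mono summable_on_add puiseux_size_summable)
  also have "\<dots> = puiseux_size a + puiseux_size b"
    unfolding puiseux_size_altdef by (intro infsum_add puiseux_size_summable)
  finally show ?thesis .
qed

instantiation puiseux :: metric_space
begin

definition dist_puiseux :: "puiseux \<Rightarrow> puiseux \<Rightarrow> real" where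
  "dist_puiseux a b = puiseux_size (a - b)"

definition uniformity_puiseux :: "(puiseux \<times> puiseux) filter" where
  "uniformity_puiseux = (INF e\<in>{0 <..}. principal {(x, y). dist x y < e})"

definition open_puiseux :: "puiseux set \<Rightarrow> bool" where
  "open_puiseux S \<longleftrightarrow> (\<forall>x\<in>S. \<forall>\<^sub>F (x', y) in uniformity. x' = x \<longrightarrow> y \<in> S)"

instance
proof
  fix a b c :: puiseux
  show "dist a b = 0 \<longleftrightarrow> a = b"
    by (simp add: dist_puiseux_def puiseux_size_zero_iff)
  show "dist a b \<le> dist a c + dist b c"
    using puiseux_size_minus_triangle[of "a - c" "b - c"] by (simp add: dist_puiseux_def)
qed (simp_all add: uniformity_puiseux_def open_puiseux_def)

end

section \<open>Functions of a Puiseux variable\<close>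

definition puiseux_lojasiewicz_bounded :: "puiseux set \<Rightarrow> (puiseux \<Rightarrow> puiseux) \<Rightarrow> bool" where
  "puiseux_lojasiewicz_bounded U \<phi> \<longleftrightarrow>
     (\<forall>\<alpha>\<in>U. \<exists>V K L. openin (top_of_set U) V \<and> \<alpha> \<in> V \<and> K > 0 \<and> L > 0 \<and>
        (\<forall>\<xi>\<in>V. real (puiseux_mult (\<phi> \<xi>)) \<le> K * real (puiseux_mult \<xi>) \<and>
               puiseux_order (\<phi> \<xi>) \<ge> - ereal L))"

lemma puiseux_supp_const: "puiseux_supp (puiseux_const c) = (if c = 0 then {} else {0})"
  by (auto simp: puiseux_supp_def coeff_puiseux_const)

lemma puiseux_const_in_valring: "puiseux_const c \<in> puiseux_valring"
proof -
  have "(LEAST q :: rat. q \<in> {0}) = 0" by (rule Least_equality) auto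
  moreover have "puiseux_const c = 0" if "c = 0" using that by (simp add: zero_puiseux_def)
  ultimately show ?thesis
    by (auto simp: puiseux_valring_def puiseux_order_def puiseux_supp_const)
qed

lemma puiseux_size_const: "puiseux_size (puiseux_const c) = norm c / (1 + norm c)"
  by (simp add: puiseux_size_def puiseux_supp_const coeff_puiseux_const)

lemma trivial_limit_puiseux_valring: "at (0 :: puiseux) within puiseux_valring \<noteq> bot"
  unfolding trivial_limit_within islimpt_approachable not_not
proof (intro allI impI)
  fix e :: real assume e: "e > 0"
  let ?x = "puiseux_const (complex_of_real e)"
  have "?x \<noteq> 0"
    using e by (metis coeff_puiseux_const coeff_puiseux_zero less_irrefl of_real_eq_0_iff)
  moreover have "dist ?x 0 < e"
    using e by (simp add: dist_puiseux_def puiseux_size_const divide_less_eq field_simps)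
  ultimately show "\<exists>x'\<in>puiseux_valring. x' \<noteq> 0 \<and> dist x' 0 < e"
    using puiseux_const_in_valring by blast
qed

text \<open>
  The derivative is only used at points of a set that is open in the valuation ring, so
  that \<open>\<phi>\<close> is evaluated inside that set for all sufficiently small increments.
\<close>

definition puiseux_has_derivative ::
  "(puiseux \<Rightarrow> puiseux) \<Rightarrow> puiseux \<Rightarrow> puiseux \<Rightarrow> bool" where
  "puiseux_has_derivative \<phi> D \<alpha> \<longleftrightarrow>
     ((\<lambda>\<delta>. (\<phi> (\<alpha> + \<delta>) - \<phi> \<alpha>) / \<delta>) \<longlongrightarrow> D) (at 0 within puiseux_valring)"

lemma puiseux_has_derivative_unique:
  "puiseux_has_derivative \<phi> D \<alpha> \<Longrightarrow> puiseux_has_derivative \<phi> D' \<alpha> \<Longrightarrow> D = D'"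
  unfolding puiseux_has_derivative_def by (rule tendsto_unique[OF trivial_limit_puiseux_valring])

definition puiseux_deriv :: "(puiseux \<Rightarrow> puiseux) \<Rightarrow> puiseux \<Rightarrow> puiseux" where
  "puiseux_deriv \<phi> \<alpha> = (THE D. puiseux_has_derivative \<phi> D \<alpha>)"

text \<open>Coefficientwise contour integral of a family of series depending on a complex parameter.\<close>

definition has_puiseux_contour_integral ::
  "(complex \<Rightarrow> puiseux) \<Rightarrow> puiseux \<Rightarrow> (real \<Rightarrow> complex) \<Rightarrow> bool" where
  "has_puiseux_contour_integral F I C \<longleftrightarrow>
     (\<forall>q. ((\<lambda>z. puiseux_coeff (F z) q) has_contour_integral puiseux_coeff I q) C)"

text \<open>The integral of \<open>g(\<mu>) d\<mu>\<close> along \<open>\<mu> = \<alpha> + z\<delta>\<close>, \<open>d\<mu> = \<delta> dz\<close>, with \<open>z\<close> on the contour \<open>C\<close>.\<close>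

definition has_puiseux_line_integral ::
  "(puiseux \<Rightarrow> puiseux) \<Rightarrow> puiseux \<Rightarrow> puiseux \<Rightarrow> puiseux \<Rightarrow> (real \<Rightarrow> complex) \<Rightarrow> bool" where
  "has_puiseux_line_integral g I \<alpha> \<delta> C \<longleftrightarrow>
     has_puiseux_contour_integral (\<lambda>z. g (\<alpha> + puiseux_const z * \<delta>) * \<delta>) I C"

definition contour_around_0 :: "(real \<Rightarrow> complex) \<Rightarrow> bool" where
  "contour_around_0 C \<longleftrightarrow> valid_path C \<and> pathfinish C = pathstart C \<and>
     0 \<notin> path_image C \<and> winding_number C 0 = 1"

end

(*
Differentiability in this metric is so restrictive that it forces phi to be locally a quadratic
polynomial, phi(alpha + delta) = phi(alpha) + phi'(alpha) delta + phi''(alpha) delta^2 / 2, with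
phi'' locally constant.  The reason is that multiplication is not continuous: an increment
delta = T zeta + s P with T huge, s tiny and P a sum of many monomials with generic exponents is
small, while a cubic term of phi puts the large coefficient s T on each of these many exponents of
the difference quotient, which therefore cannot converge.

On a line, the coefficients of phi are holomorphic, because the order bound turns products into
finite sums.  Along alpha + T zeta, with zeta divisible by a high power of y, they are polynomials
in T, and testing differentiability on the increments above bounds T d/dT phi - phi + phi(alpha)
by a multiple of |T|^2, so these polynomials are quadratic.  Quadratic functions satisfy the
trapezoid rule, and the trapezoid rule on the three sides of a triangle shows that phi' is affine.
*)
theory Submission
  imports Defs
begin

section \<open>Coefficients and orders\<close>

text \<open>The exponent 2 arises as follows. At W = T \<zeta> the difference quotient has, in
  direction P, the derivative P H / W^2, where H = T d/dT \<phi> - \<phi> + \<phi>(\<alpha>).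
  Choosing P = \<zeta>^2 P0 cancels \<zeta> from the denominator, and P0 H / T^2 contains, for each
  monomial of P0, a copy of every coefficient of H divided by T^2. A coefficient at exponent q,
  however large, adds at most 2^(-q) to the size, so one copy need not contradict convergence. The
  contradiction comes from the number J of copies, which therefore must land on distinct exponents.
  Neither J nor s depends on T, so the bound C |T|^2 has a constant C independent of T. A term c_j
  T^j of \<phi> enters H as (j - 1) c_j T^j for j > 0, so it can survive only for j at most 2.

  T can be arbitrarily large because |a| / (1 + |a|) is bounded: a high power of y makes all complex
  multiples of a series small simultaneously. Lines alone leave open how the quadratic coefficient
  depends on the direction; comparing three directions in a triangle settles this.\<close>

text \<open>A lower bound for the order with rational threshold. The zero series satisfies it for
  every \<open>r\<close>, so no case distinction on infinite order arises.\<close>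

definition puiseux_ord_ge :: "puiseux \<Rightarrow> rat \<Rightarrow> bool" where
  "puiseux_ord_ge a r \<longleftrightarrow> (\<forall>q<r. puiseux_coeff a q = 0)"

lemma puiseux_ord_geD: "puiseux_ord_ge a r \<Longrightarrow> q < r \<Longrightarrow> puiseux_coeff a q = 0"
  by (simp add: puiseux_ord_ge_def)

lemma puiseux_common_denominator:
  obtains N :: nat where "N > 0" "\<And>q. puiseux_coeff a q \<noteq> 0 \<Longrightarrow> q * of_nat N \<in> \<int>"
proof -
  obtain N :: nat and m :: int
    where N: "N > 0" "puiseux_supp a \<subseteq> (\<lambda>i. of_int i / of_nat N) ` {m..}"
    by (rule puiseux_supp_subset)
  show ?thesis
  proof (rule that[of N])
    fix q assume "puiseux_coeff a q \<noteq> 0"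
    then have "q \<in> (\<lambda>i. of_int i / of_nat N) ` {m..}" using N by (auto simp: puiseux_supp_def)
    then show "q * of_nat N \<in> \<int>" using N by auto
  qed (use N in auto)
qed

lemma puiseux_finite_below: "finite {q. puiseux_coeff a q \<noteq> 0 \<and> q \<le> s}"
proof -
  obtain N :: nat and m :: int
    where N: "N > 0" "puiseux_supp a \<subseteq> (\<lambda>i. of_int i / of_nat N) ` {m..}"
    by (rule puiseux_supp_subset)
  have "{q. puiseux_coeff a q \<noteq> 0 \<and> q \<le> s} \<subseteq> (\<lambda>i. of_int i / of_nat N) ` {m..\<lfloor>s * of_nat N\<rfloor>}"
  proof
    fix q assume q: "q \<in> {q. puiseux_coeff a q \<noteq> 0 \<and> q \<le> s}"
    then obtain i where i: "i \<ge> m" "q = of_int i / of_nat N" using N by (auto simp: puiseux_supp_def)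
    have "of_int i \<le> s * of_nat N" using q i N by (simp add: field_simps)
    then have "i \<le> \<lfloor>s * of_nat N\<rfloor>" by (simp add: le_floor_iff)
    with i show "q \<in> (\<lambda>i. of_int i / of_nat N) ` {m..\<lfloor>s * of_nat N\<rfloor>}" by auto
  qed
  then show ?thesis by (rule finite_subset) auto
qed

lemma puiseux_leading_exponent:
  assumes "a \<noteq> 0"
  obtains w where "puiseux_coeff a w \<noteq> 0" "puiseux_ord_ge a w"
proof -
  obtain s where s: "puiseux_coeff a s \<noteq> 0"
    using assms puiseux_eqI[of a 0] by (auto simp: coeff_puiseux_zero)
  let ?S = "{q. puiseux_coeff a q \<noteq> 0 \<and> q \<le> s}"
  have fin: "finite ?S" by (rule puiseux_finite_below)
  have ne: "?S \<noteq> {}" using s by auto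
  show ?thesis
  proof (rule that[of "Min ?S"])
    show "puiseux_coeff a (Min ?S) \<noteq> 0" using Min_in[OF fin ne] by auto
    show "puiseux_ord_ge a (Min ?S)"
      unfolding puiseux_ord_ge_def
    proof (intro allI impI, rule ccontr)
      fix q assume q: "q < Min ?S" "puiseux_coeff a q \<noteq> 0"
      then have "q \<in> ?S" using Min_le[OF fin, of s] s by auto
      then have "Min ?S \<le> q" by (rule Min_le[OF fin])
      with q show False by simp
    qed
  qed
qed

text \<open>Both facts rest on the order being the leading exponent. The second one passes from a
  real bound, as in the Lojasiewicz condition, to a rational threshold.\<close>

lemma puiseux_valring_iff: "a \<in> puiseux_valring \<longleftrightarrow> puiseux_ord_ge a 0"
  and puiseux_order_geD: "puiseux_order a \<ge> ereal x \<Longrightarrow> of_rat r \<le> x \<Longrightarrow> puiseux_ord_ge a r"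
proof -
  have *: "puiseux_order a = ereal (of_rat w)" if "puiseux_coeff a w \<noteq> 0" "puiseux_ord_ge a w" for w
  proof -
    have "a \<noteq> 0" using that by (auto simp: coeff_puiseux_zero)
    moreover have "(LEAST q. q \<in> puiseux_supp a) = w"
      using that by (intro Least_equality) (auto simp: puiseux_supp_def puiseux_ord_ge_def not_le[symmetric])
    ultimately show ?thesis by (simp add: puiseux_order_def)
  qed
  show "a \<in> puiseux_valring \<longleftrightarrow> puiseux_ord_ge a 0"
  proof (cases "a = 0")
    case True
    then show ?thesis by (simp add: puiseux_valring_def puiseux_order_def puiseux_ord_ge_def coeff_puiseux_zero)
  next
    case False
    then obtain w where w: "puiseux_coeff a w \<noteq> 0" "puiseux_ord_ge a w" by (rule puiseux_leading_exponent)
    have "puiseux_ord_ge a 0 \<longleftrightarrow> w \<ge> 0"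
      using w by (auto simp: puiseux_ord_ge_def not_le[symmetric])
    then show ?thesis using *[OF w] by (simp add: puiseux_valring_def)
  qed
  show "puiseux_ord_ge a r" if "puiseux_order a \<ge> ereal x" "of_rat r \<le> x"
  proof (cases "a = 0")
    case True
    then show ?thesis by (simp add: puiseux_ord_ge_def coeff_puiseux_zero)
  next
    case False
    then obtain w where w: "puiseux_coeff a w \<noteq> 0" "puiseux_ord_ge a w" by (rule puiseux_leading_exponent)
    then have "(of_rat r :: real) \<le> of_rat w" using *[OF w] that by simp
    then have "r \<le> w" by (simp add: of_rat_less_eq)
    with w show ?thesis by (auto simp: puiseux_ord_ge_def)
  qed
qed

lemma coeff_puiseux_mult:
  assumes A: "finite A" "{p. puiseux_coeff a p \<noteq> 0 \<and> puiseux_coeff b (q - p) \<noteq> 0} \<subseteq> A"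
  shows "puiseux_coeff (a * b) q = (\<Sum>p\<in>A. puiseux_coeff a p * puiseux_coeff b (q - p))"
proof -
  let ?S = "{p. puiseux_coeff a p \<noteq> 0 \<and> puiseux_coeff b (q - p) \<noteq> 0}"
  have A_S: "(\<Sum>p\<in>A. puiseux_coeff a p * puiseux_coeff b (q - p))
       = (\<Sum>p\<in>?S. puiseux_coeff a p * puiseux_coeff b (q - p))"
    using A by (intro sum.mono_neutral_right) auto
  obtain N f g where *: "N > 0" "fls_conv_radius f > 0" "fls_conv_radius g > 0"
    "a = puiseux_of_fls N f" "b = puiseux_of_fls N g"
    by (rule puiseux_cases2)
  have ca: "puiseux_coeff a = frac_fls N f" and cb: "puiseux_coeff b = frac_fls N g"
    using * by (simp_all add: coeff_puiseux_of_fls)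
  have cab: "puiseux_coeff (a * b) q = frac_fls N (f * g) q"
    using * by (simp add: times_puiseux_of_fls coeff_puiseux_of_fls fls_conv_radius_mult_pos)
  let ?h = "\<lambda>i. of_int i / of_nat N :: rat"
  have inj: "inj_on ?h I" for I using * by (auto simp: inj_on_def)
  show ?thesis
  proof (cases "q * of_nat N \<in> \<int>")
    case True
    then obtain m where "q * of_nat N = of_int m" by (auto elim: Ints_cases)
    then have q: "q = ?h m" using * by (simp add: field_simps)
    have qd: "q - ?h i = ?h (m - i)" for i by (simp add: q diff_divide_distrib)
    let ?I = "{fls_subdegree f..m - fls_subdegree g}"
    have "?S \<subseteq> ?h ` ?I"
    proof
      fix p assume p: "p \<in> ?S"
      then have "frac_fls N f p \<noteq> 0" by (simp add: ca)
      then obtain i where i: "p = ?h i" "f $$ i \<noteq> 0" using *(1) by (rule frac_fls_nonzeroE)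
      have "frac_fls N g (q - ?h i) \<noteq> 0" using p i by (simp add: cb)
      then have "g $$ (m - i) \<noteq> 0" unfolding qd frac_fls_of_int_divide[OF *(1)] .
      then have "i \<in> ?I" using i fls_subdegree_leI[of f i] fls_subdegree_leI[of g "m - i"] by simp
      with i show "p \<in> ?h ` ?I" by blast
    qed
    then have "(\<Sum>p\<in>?S. puiseux_coeff a p * puiseux_coeff b (q - p))
         = (\<Sum>p\<in>?h ` ?I. puiseux_coeff a p * puiseux_coeff b (q - p))"
      by (intro sum.mono_neutral_left) auto
    also have "\<dots> = (\<Sum>i\<in>?I. puiseux_coeff a (?h i) * puiseux_coeff b (q - ?h i))"
      by (subst sum.reindex[OF inj]) simp
    also have "\<dots> = (\<Sum>i\<in>?I. f $$ i * g $$ (m - i))"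
      unfolding qd ca cb frac_fls_of_int_divide[OF *(1)] ..
    also have "\<dots> = (f * g) $$ m" by (rule fls_times_nth(2)[symmetric])
    also have "\<dots> = frac_fls N (f * g) q" unfolding q frac_fls_of_int_divide[OF *(1)] ..
    finally show ?thesis using A_S cab by simp
  next
    case False
    have "?S = {}"
    proof safe
      fix p assume "puiseux_coeff a p \<noteq> 0" "puiseux_coeff b (q - p) \<noteq> 0"
      then have "p * of_nat N \<in> \<int>" "(q - p) * of_nat N \<in> \<int>"
        by (auto simp: ca cb frac_fls_def split: if_splits)
      then have "p * of_nat N + (q - p) * of_nat N \<in> \<int>" by (rule Ints_add)
      with False show "p \<in> {}" by (simp add: algebra_simps)
    qed
    with False A_S show ?thesis by (simp add: cab frac_fls_def)
  qed
qed

lemma coeff_puiseux_const_mult: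
  "puiseux_coeff (puiseux_const c * a) q = c * puiseux_coeff a q"
  by (subst coeff_puiseux_mult[of "{0}"]) (auto simp: coeff_puiseux_const split: if_splits)

lemma coeff_puiseux_sum: "puiseux_coeff (sum f A) q = (\<Sum>x\<in>A. puiseux_coeff (f x) q)"
  by (induction A rule: infinite_finite_induct) (auto simp: coeff_puiseux_zero coeff_puiseux_plus)

lemma coeff_puiseux_uminus: "puiseux_coeff (- a) q = - puiseux_coeff a q"
  using coeff_puiseux_minus[of 0 a q] by (simp add: coeff_puiseux_zero)

lemmas coeff_puiseux_simps = coeff_puiseux_zero coeff_puiseux_plus coeff_puiseux_minus
  coeff_puiseux_uminus coeff_puiseux_const_mult coeff_puiseux_sum

lemma puiseux_const_0 [simp]: "puiseux_const 0 = 0"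
  by (simp add: zero_puiseux_def)

lemma puiseux_const_1 [simp]: "puiseux_const 1 = 1"
  by (simp add: one_puiseux_def)

lemma puiseux_const_add: "puiseux_const (x + y) = puiseux_const x + puiseux_const y"
  by (rule puiseux_eqI) (simp add: coeff_puiseux_plus coeff_puiseux_const)

lemma puiseux_const_diff: "puiseux_const (x - y) = puiseux_const x - puiseux_const y"
  by (rule puiseux_eqI) (simp add: coeff_puiseux_minus coeff_puiseux_const)

lemma puiseux_const_mult: "puiseux_const (x * y) = puiseux_const x * puiseux_const y"
  by (rule puiseux_eqI) (simp add: coeff_puiseux_const_mult coeff_puiseux_const)

lemma puiseux_const_power: "puiseux_const (x ^ n) = puiseux_const x ^ n"
  by (induction n) (simp_all add: puiseux_const_mult)

lemma puiseux_const_of_nat [simp]: "puiseux_const (of_nat n) = of_nat n"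
  by (induction n) (simp_all add: puiseux_const_add)

lemma puiseux_const_numeral [simp]: "puiseux_const (numeral n) = numeral n"
  using puiseux_const_of_nat[of "numeral n"] by simp

lemma puiseux_const_eq_0_iff [simp]: "puiseux_const x = 0 \<longleftrightarrow> x = 0"
  by (metis coeff_puiseux_const coeff_puiseux_zero puiseux_const_0)

lemma puiseux_const_inverse: "puiseux_const (inverse x) = inverse (puiseux_const x)"
proof (cases "x = 0")
  case False
  then have "puiseux_const x * puiseux_const (inverse x) = 1"
    by (simp flip: puiseux_const_mult)
  then show ?thesis by (rule inverse_unique[symmetric])
qed auto

lemma puiseux_const_divide: "puiseux_const (x / y) = puiseux_const x / puiseux_const y"
  by (simp add: divide_inverse puiseux_const_mult puiseux_const_inverse)

definition puiseux_monom :: "rat \<Rightarrow> puiseux" where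
  "puiseux_monom p = Abs_puiseux (\<lambda>q. if q = p then 1 else 0)"

lemma coeff_puiseux_monom: "puiseux_coeff (puiseux_monom p) q = (if q = p then 1 else 0)"
proof -
  obtain i N where p: "p = of_int i / of_nat N" "N > 0"
    by (metis Fract_of_int_quotient Rat_cases of_int_of_nat_eq pos_int_cases)
  have "(\<lambda>q. if q = p then 1 else 0) = frac_fls N (fls_X_intpow i)"
    using p by (intro frac_fls_eqI) auto
  moreover have "fls_conv_radius (fls_X_intpow i :: complex fls) > 0" by simp
  ultimately have "(\<lambda>q. if q = p then 1 else 0) \<in> {frac_fls N f | N f. N > 0 \<and> fls_conv_radius f > 0}"
    using p by blast
  then show ?thesis unfolding puiseux_monom_def by (subst Abs_puiseux_inverse) auto
qed

lemma coeff_puiseux_monom_mult: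
  "puiseux_coeff (puiseux_monom p * a) q = puiseux_coeff a (q - p)"
  by (subst coeff_puiseux_mult[of "{p}"]) (auto simp: coeff_puiseux_monom split: if_splits)

lemma puiseux_monom_neq_0 [simp]: "puiseux_monom p \<noteq> 0"
  by (metis coeff_puiseux_monom coeff_puiseux_zero zero_neq_one)

section \<open>Arithmetic of lower bounds for the order\<close>

lemma puiseux_ord_ge_mono: "puiseux_ord_ge a r \<Longrightarrow> s \<le> r \<Longrightarrow> puiseux_ord_ge a s"
  by (auto simp: puiseux_ord_ge_def)

lemma puiseux_ord_ge_add: "puiseux_ord_ge a r \<Longrightarrow> puiseux_ord_ge b r \<Longrightarrow> puiseux_ord_ge (a + b) r"
  by (auto simp: puiseux_ord_ge_def coeff_puiseux_simps)

lemma puiseux_ord_ge_diff: "puiseux_ord_ge a r \<Longrightarrow> puiseux_ord_ge b r \<Longrightarrow> puiseux_ord_ge (a - b) r"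
  by (auto simp: puiseux_ord_ge_def coeff_puiseux_simps)

lemma puiseux_ord_ge_sum: "(\<And>x. x \<in> A \<Longrightarrow> puiseux_ord_ge (f x) r) \<Longrightarrow> puiseux_ord_ge (sum f A) r"
  by (auto simp: puiseux_ord_ge_def coeff_puiseux_simps)

lemma puiseux_ord_ge_const_mult: "puiseux_ord_ge a r \<Longrightarrow> puiseux_ord_ge (puiseux_const c * a) r"
  by (auto simp: puiseux_ord_ge_def coeff_puiseux_simps)

lemma puiseux_ord_ge_monom: "r \<le> p \<Longrightarrow> puiseux_ord_ge (puiseux_monom p) r"
  by (auto simp: puiseux_ord_ge_def coeff_puiseux_monom)

lemma puiseux_ord_ge_mult:
  assumes "puiseux_ord_ge a r" "puiseux_ord_ge b s"
  shows "puiseux_ord_ge (a * b) (r + s)"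
  unfolding puiseux_ord_ge_def
proof (intro allI impI)
  fix q assume q: "q < r + s"
  have "{p. puiseux_coeff a p \<noteq> 0 \<and> puiseux_coeff b (q - p) \<noteq> 0} \<subseteq> {}"
  proof safe
    fix p assume *: "puiseux_coeff a p \<noteq> 0" "puiseux_coeff b (q - p) \<noteq> 0"
    have "\<not> p < r" using * assms puiseux_ord_geD by blast
    moreover have "\<not> q - p < s" using * assms puiseux_ord_geD by blast
    ultimately show "p \<in> {}" using q by linarith
  qed
  then show "puiseux_coeff (a * b) q = 0" by (subst coeff_puiseux_mult[of "{}"]) auto
qed

text \<open>Leading coefficients multiply to a nonzero number, so orders add exactly. Dividing by
  \<open>a\<close> therefore lowers an order bound by the leading exponent \<open>w\<close> and no
  more.\<close>

lemma puiseux_ord_ge_cancel: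
  assumes ab: "puiseux_ord_ge (a * b) r" and a: "puiseux_coeff a w \<noteq> 0" "puiseux_ord_ge a w"
  shows "puiseux_ord_ge b (r - w)"
proof (cases "b = 0")
  case False
  then obtain v where v: "puiseux_coeff b v \<noteq> 0" "puiseux_ord_ge b v"
    by (rule puiseux_leading_exponent)
  have "puiseux_coeff (a * b) (w + v) = puiseux_coeff a w * puiseux_coeff b v"
  proof (subst coeff_puiseux_mult[of "{w}"])
    show "{p. puiseux_coeff a p \<noteq> 0 \<and> puiseux_coeff b (w + v - p) \<noteq> 0} \<subseteq> {w}"
    proof safe
      fix p assume *: "puiseux_coeff a p \<noteq> 0" "puiseux_coeff b (w + v - p) \<noteq> 0"
      have "\<not> p < w" using * a puiseux_ord_geD by blast
      moreover have "\<not> w + v - p < v" using * v puiseux_ord_geD by blast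
      ultimately show "p = w" by linarith
    qed
  qed auto
  with a v have "puiseux_coeff (a * b) (w + v) \<noteq> 0" by simp
  then have "\<not> w + v < r" using ab puiseux_ord_geD by blast
  then show ?thesis using v(2) by (elim puiseux_ord_ge_mono) simp
qed (simp add: puiseux_ord_ge_def coeff_puiseux_simps)

lemma puiseux_valring_add: "a \<in> puiseux_valring \<Longrightarrow> b \<in> puiseux_valring \<Longrightarrow> a + b \<in> puiseux_valring"
  by (simp add: puiseux_valring_iff puiseux_ord_ge_add)

lemma puiseux_valring_diff: "a \<in> puiseux_valring \<Longrightarrow> b \<in> puiseux_valring \<Longrightarrow> a - b \<in> puiseux_valring"
  by (simp add: puiseux_valring_iff puiseux_ord_ge_diff)

lemma puiseux_valring_mult: "a \<in> puiseux_valring \<Longrightarrow> b \<in> puiseux_valring \<Longrightarrow> a * b \<in> puiseux_valring"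
  using puiseux_ord_ge_mult[of a 0 b 0] by (simp add: puiseux_valring_iff)

lemma puiseux_valring_const_mult: "a \<in> puiseux_valring \<Longrightarrow> puiseux_const c * a \<in> puiseux_valring"
  by (simp add: puiseux_valring_iff puiseux_ord_ge_const_mult)

lemma puiseux_valring_monom: "p \<ge> 0 \<Longrightarrow> puiseux_monom p \<in> puiseux_valring"
  by (simp add: puiseux_valring_iff puiseux_ord_ge_monom)

section \<open>The size function\<close>

lemma puiseux_size_sum_le:
  assumes "finite A"
  shows "(\<Sum>q\<in>A. 2 powr (- of_rat q) * (norm (puiseux_coeff a q) / (1 + norm (puiseux_coeff a q))))
           \<le> puiseux_size a"
  unfolding puiseux_size_altdef
  by (rule finite_sum_le_infsum[OF puiseux_size_summable assms]) auto

lemma puiseux_size_mono: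
  assumes "\<And>q. norm (puiseux_coeff a q) \<le> norm (puiseux_coeff b q)"
  shows "puiseux_size a \<le> puiseux_size b"
  unfolding puiseux_size_altdef
proof (rule infsum_mono[OF puiseux_size_summable puiseux_size_summable])
  fix q
  have "s / (1 + s) \<le> t / (1 + t)" if "0 \<le> s" "s \<le> t" for s t :: real
    using that by (simp add: field_simps)
  then show "2 powr - real_of_rat q * (norm (puiseux_coeff a q) / (1 + norm (puiseux_coeff a q)))
         \<le> 2 powr - real_of_rat q * (norm (puiseux_coeff b q) / (1 + norm (puiseux_coeff b q)))"
    by (intro mult_left_mono) (use assms in auto)
qed

lemma puiseux_size_zero [simp]: "puiseux_size 0 = 0"
  by (simp add: puiseux_size_zero_iff)

lemma puiseux_size_minus_commute: "puiseux_size (a - b) = puiseux_size (b - a)"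
  by (rule antisym; rule puiseux_size_mono) (simp_all add: coeff_puiseux_simps norm_minus_commute)

lemma puiseux_size_triangle: "puiseux_size (a + b) \<le> puiseux_size a + puiseux_size b"
  using puiseux_size_minus_triangle[of a "0 - b"] puiseux_size_minus_commute[of 0 b] by simp

lemma puiseux_size_sum_triangle: "puiseux_size (sum f A) \<le> (\<Sum>x\<in>A. puiseux_size (f x))"
proof (induction A rule: infinite_finite_induct)
  case (insert x A)
  then show ?case using puiseux_size_triangle[of "f x" "sum f A"] by simp
qed auto

text \<open>A substitute for homogeneity, which the size does not have.\<close>

lemma puiseux_size_double: "puiseux_size (2 * a) \<le> 2 * puiseux_size a"
  using puiseux_size_triangle[of a a] by (simp only: mult_2)

lemma puiseux_size_const_mult_mono:
  "norm c \<le> norm c' \<Longrightarrow> puiseux_size (puiseux_const c * a) \<le> puiseux_size (puiseux_const c' * a)"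
  by (rule puiseux_size_mono) (simp add: coeff_puiseux_simps norm_mult mult_right_mono)

lemma puiseux_size_monom_mult:
  "puiseux_size (puiseux_monom p * a) = 2 powr (- of_rat p) * puiseux_size a"
proof -
  let ?s = "\<lambda>q. norm (puiseux_coeff a q) / (1 + norm (puiseux_coeff a q))"
  have "puiseux_size (puiseux_monom p * a) = (\<Sum>\<^sub>\<infinity>q. 2 powr (- of_rat q) * ?s (q - p))"
    by (simp add: puiseux_size_altdef coeff_puiseux_monom_mult)
  also have "\<dots> = (\<Sum>\<^sub>\<infinity>q. 2 powr (- of_rat (q + p)) * ?s q)"
    by (rule infsum_reindex_bij_witness[of _ "\<lambda>q. q + p" "\<lambda>q. q - p"]) auto
  also have "\<dots> = (\<Sum>\<^sub>\<infinity>q. 2 powr (- of_rat p) * (2 powr (- of_rat q) * ?s q))"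
    by (simp add: of_rat_add powr_diff powr_minus field_simps)
  also have "\<dots> = 2 powr (- of_rat p) * puiseux_size a"
    unfolding puiseux_size_altdef by (rule infsum_cmult_right')
  finally show ?thesis .
qed

lemma puiseux_size_monom_mult_le: "p \<ge> 0 \<Longrightarrow> puiseux_size (puiseux_monom p * a) \<le> puiseux_size a"
  unfolding puiseux_size_monom_mult
  using powr_mono[of "- of_rat p" 0 2] by (intro mult_left_le_one_le puiseux_size_nonneg) auto

text \<open>The exponents lie in an arithmetic progression bounded below, so the weights are
  dominated by a geometric series. Their sum bounds the size of every series with support in that of
  \<open>a\<close>.\<close>

lemma puiseux_supp_weight_summable: "(\<lambda>q. 2 powr (- of_rat q) :: real) summable_on puiseux_supp a"
proof -
  obtain N :: nat and m :: int
    where N: "N > 0" "puiseux_supp a \<subseteq> (\<lambda>i. of_int i / of_nat N) ` {m..}"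
    by (rule puiseux_supp_subset)
  define h where "h = (\<lambda>k :: nat. of_int (m + int k) / of_nat N :: rat)"
  have inj: "inj h" using N by (auto simp: h_def inj_on_def)
  have sub: "puiseux_supp a \<subseteq> range h"
  proof
    fix q assume "q \<in> puiseux_supp a"
    with N obtain i where "i \<ge> m" "q = of_int i / of_nat N" by auto
    then have "q = h (nat (i - m))" by (simp add: h_def)
    then show "q \<in> range h" by blast
  qed
  define c where "c = 2 powr (- (1 / real N))"
  have c: "0 < c" "c < 1" using N by (auto simp: c_def powr_less_one)
  have eq: "2 powr (- of_rat (h k)) = 2 powr (- (of_int m / real N)) * c ^ k" for k
  proof -
    have "- of_rat (h k) = - (of_int m / real N) + real k * (- (1 / real N))"
      by (simp add: h_def of_rat_divide of_rat_add add_divide_distrib)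
    then show ?thesis by (simp only: powr_add c_def powr_power)
  qed
  have "summable (\<lambda>k. norm (2 powr (- of_rat (h k)) :: real))"
    using c by (simp add: eq abs_mult summable_geometric)
  then have "((\<lambda>q. 2 powr (- of_rat q) :: real) \<circ> h) summable_on UNIV"
    by (intro norm_summable_imp_summable_on) (simp add: o_def)
  then have "(\<lambda>q. 2 powr (- of_rat q) :: real) summable_on range h"
    using inj by (simp add: summable_on_reindex)
  then show ?thesis using sub by (rule summable_on_subset_banach)
qed

text \<open>The bound is uniform in \<open>c\<close> because \<open>x / (1 + x)\<close> is bounded; the size is not a norm.\<close>

lemma puiseux_size_const_mult_bounded:
  obtains S where "\<And>c. puiseux_size (puiseux_const c * a) \<le> S"
proof
  fix c
  let ?x = "puiseux_const c * a"
  have sub: "puiseux_supp ?x \<subseteq> puiseux_supp a" by (auto simp: puiseux_supp_def coeff_puiseux_simps)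
  have "puiseux_size ?x \<le> (\<Sum>\<^sub>\<infinity>q\<in>puiseux_supp ?x. 2 powr (- of_rat q))"
    unfolding puiseux_size_def
  proof (rule infsum_mono[OF puiseux_size_summable puiseux_supp_weight_summable])
    fix q
    have le_1: "s / (1 + s) \<le> 1" if "0 \<le> s" for s :: real using that by (simp add: field_simps)
    show "2 powr - real_of_rat q * (norm (puiseux_coeff ?x q) / (1 + norm (puiseux_coeff ?x q)))
         \<le> 2 powr - real_of_rat q" by (intro mult_left_le le_1) auto
  qed
  also have "\<dots> \<le> (\<Sum>\<^sub>\<infinity>q\<in>puiseux_supp a. 2 powr (- of_rat q))"
    using sub by (intro infsum_mono_neutral puiseux_supp_weight_summable) auto
  finally show "puiseux_size ?x \<le> (\<Sum>\<^sub>\<infinity>q\<in>puiseux_supp a. 2 powr (- of_rat q))" .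
qed

text \<open>Multiplication by y^m scales the size by 2^(-m), and the sizes of all scalar multiples
  of \<open>a\<close> have a common bound. Thus one \<open>m\<close> works for all \<open>c\<close>,
  and a whole complex line fits into a small ball.\<close>

lemma puiseux_size_monom_const_mult_small:
  assumes "e > 0"
  obtains m :: nat where "m > 0" "\<And>c. puiseux_size (puiseux_const c * (puiseux_monom (of_nat m) * a)) < e"
proof -
  obtain S where S: "\<And>c. puiseux_size (puiseux_const c * a) \<le> S"
    using puiseux_size_const_mult_bounded by blast
  have "S \<ge> 0" using order_trans[OF puiseux_size_nonneg S[of 0]] .
  obtain m :: nat where m: "(1 / 2 :: real) ^ m < e / (S + 1)"
    using real_arch_pow_inv[of "e / (S + 1)" "1 / 2"] assms \<open>S \<ge> 0\<close> by auto
  show ?thesis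
  proof (rule that[of "Suc m"])
    fix c
    have "puiseux_size (puiseux_const c * (puiseux_monom (of_nat (Suc m)) * a))
        = 2 powr (- real (Suc m)) * puiseux_size (puiseux_const c * a)"
      using puiseux_size_monom_mult[of "of_nat (Suc m)" "puiseux_const c * a"]
      by (simp only: mult.left_commute[of "puiseux_monom _"] of_rat_of_nat_eq)
    also have "2 powr (- real (Suc m)) = (1 / 2) ^ Suc m"
      by (simp only: powr_minus powr_realpow zero_less_numeral power_one_over inverse_eq_divide)
    also have "(1 / 2) ^ Suc m * puiseux_size (puiseux_const c * a) \<le> (1 / 2) ^ m * S"
      using S[of c] puiseux_size_nonneg by (intro mult_mono) (auto intro: power_decreasing)
    also have "\<dots> \<le> (1 / 2) ^ m * (S + 1)" by simp
    also have "\<dots> < e" using m \<open>S \<ge> 0\<close> by (simp add: field_simps)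
    finally show "puiseux_size (puiseux_const c * (puiseux_monom (of_nat (Suc m)) * a)) < e" .
  qed simp
qed

text \<open>For |c| at most 1 the tail of the size series is dominated by the tail for c = 1, and
  the remaining finitely many terms are continuous in \<open>c\<close>.\<close>

lemma puiseux_size_const_mult_small:
  assumes e: "e > 0"
  obtains r where "r > 0" "\<And>c. norm c < r \<Longrightarrow> puiseux_size (puiseux_const c * a) < e"
proof -
  let ?t = "\<lambda>c q. 2 powr (- of_rat q) * (norm (puiseux_coeff (puiseux_const c * a) q)
                / (1 + norm (puiseux_coeff (puiseux_const c * a) q))) :: real"
  have size: "puiseux_size (puiseux_const c * a) = infsum (?t c) UNIV" for c
    by (simp add: puiseux_size_altdef)
  have summ: "?t c summable_on A" for c A by (rule puiseux_size_summable)
  have "(?t 1 has_sum infsum (?t 1) UNIV) UNIV" using summ by (rule has_sum_infsum)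
  then have "\<forall>\<^sub>F F in finite_subsets_at_top UNIV. dist (sum (?t 1) F) (infsum (?t 1) UNIV) < e / 2"
    unfolding has_sum_def using e by (intro tendstoD) auto
  then obtain F where F: "finite F" "dist (sum (?t 1) F) (infsum (?t 1) UNIV) < e / 2"
    unfolding eventually_finite_subsets_at_top by blast
  have split: "infsum (?t c) UNIV = sum (?t c) F + infsum (?t c) (- F)" for c
    using infsum_Un_disjoint[OF summ[of c F] summ[of c "- F"]] F(1) by simp
  have tail: "infsum (?t c) (- F) < e / 2" if "norm c \<le> 1" for c
  proof -
    have "infsum (?t c) (- F) \<le> infsum (?t 1) (- F)"
    proof (rule infsum_mono[OF summ summ])
      fix q
      have "s / (1 + s) \<le> t / (1 + t)" if "0 \<le> s" "s \<le> t" for s t :: real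
        using that by (simp add: field_simps)
      then show "?t c q \<le> ?t 1 q"
        using that by (intro mult_left_mono) (auto simp: coeff_puiseux_simps norm_mult mult_left_le_one_le)
    qed
    also have "\<dots> < e / 2" using F(2) split[of 1] by (simp add: dist_real_def)
    finally show ?thesis .
  qed
  have "((\<lambda>c. sum (?t c) F) \<longlongrightarrow> (\<Sum>q\<in>F. 2 powr (- of_rat q) * (norm (0 * puiseux_coeff a q)
                / (1 + norm (0 * puiseux_coeff a q))))) (at 0)"
    unfolding coeff_puiseux_const_mult by (intro tendsto_intros) auto
  then have "((\<lambda>c. sum (?t c) F) \<longlongrightarrow> 0) (at 0)" by simp
  from tendstoD[OF this, of "e / 2"] e
  obtain r where r: "r > 0" "\<And>c. c \<noteq> 0 \<Longrightarrow> dist c 0 < r \<Longrightarrow> dist (sum (?t c) F) 0 < e / 2"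
    unfolding eventually_at by auto
  show ?thesis
  proof (rule that[of "min r 1"])
    fix c :: complex assume c: "norm c < min r 1"
    show "puiseux_size (puiseux_const c * a) < e"
    proof (cases "c = 0")
      case False
      with c have "sum (?t c) F < e / 2" using r(2)[of c] by (simp add: dist_norm)
      moreover have "infsum (?t c) (- F) < e / 2" using c by (intro tail) simp
      ultimately show ?thesis unfolding size split by linarith
    qed (use e in auto)
  qed (use r in simp)
qed

text \<open>The map x / (1 + x) is strictly increasing for x at least 0, so a single summand of the
  size below the weight times e / (1 + e) forces its coefficient below e.\<close>

lemma tendsto_coeff_puiseux:
  assumes "(f \<longlongrightarrow> L) F"
  shows "((\<lambda>x. puiseux_coeff (f x) q) \<longlongrightarrow> puiseux_coeff L q) F"
proof (rule tendstoI)
  fix e :: real assume e: "e > 0"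
  let ?d = "2 powr (- of_rat q) * (e / (1 + e))"
  have "?d > 0" using e by simp
  then have "\<forall>\<^sub>F x in F. dist (f x) L < ?d" by (rule tendstoD[OF assms])
  then show "\<forall>\<^sub>F x in F. dist (puiseux_coeff (f x) q) (puiseux_coeff L q) < e"
  proof eventually_elim
    case (elim x)
    let ?u = "norm (puiseux_coeff (f x - L) q)"
    have "2 powr (- of_rat q) * (?u / (1 + ?u)) \<le> puiseux_size (f x - L)"
      using puiseux_size_sum_le[of "{q}" "f x - L"] by simp
    then have "2 powr (- of_rat q) * (?u / (1 + ?u)) < ?d"
      using elim by (simp add: dist_puiseux_def)
    then have "?u / (1 + ?u) < e / (1 + e)" by (subst (asm) mult_less_cancel_left_pos) auto
    moreover have "1 + ?u > 0" by (rule add_pos_nonneg) auto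
    ultimately have "?u < e" using e by (simp add: field_simps)
    then show ?case by (simp add: dist_norm coeff_puiseux_minus)
  qed
qed

section \<open>Differentiable functions along lines\<close>

locale puiseux_differentiable =
  fixes U :: "puiseux set" and \<phi> :: "puiseux \<Rightarrow> puiseux"
  assumes U_open: "openin (top_of_set puiseux_valring) U"
    and bounded: "puiseux_lojasiewicz_bounded U \<phi>"
    and differentiable: "\<And>\<alpha>. \<alpha> \<in> U \<Longrightarrow> \<exists>D. puiseux_has_derivative \<phi> D \<alpha>"
begin

abbreviation \<phi>' :: "puiseux \<Rightarrow> puiseux" where "\<phi>' \<equiv> puiseux_deriv \<phi>"

lemma U_valring: "\<alpha> \<in> U \<Longrightarrow> \<alpha> \<in> puiseux_valring"
  using openin_imp_subset[OF U_open] by blast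

lemma has_deriv:
  assumes "\<alpha> \<in> U"
  shows "((\<lambda>\<delta>. (\<phi> (\<alpha> + \<delta>) - \<phi> \<alpha>) / \<delta>) \<longlongrightarrow> \<phi>' \<alpha>) (at 0 within puiseux_valring)"
proof -
  obtain D where D: "puiseux_has_derivative \<phi> D \<alpha>" using differentiable[OF assms] by blast
  then have "\<phi>' \<alpha> = D" unfolding puiseux_deriv_def
    by (intro the_equality) (auto intro: puiseux_has_derivative_unique)
  with D show ?thesis by (simp add: puiseux_has_derivative_def)
qed

text \<open>Turns the two local hypotheses into one metric ball of increments on which the function
  is defined and its order is bounded below by a fixed rational.\<close>

lemma local_ball:
  assumes "\<alpha> \<in> U"
  obtains d r where "d > 0" "\<And>\<delta>. \<delta> \<in> puiseux_valring \<Longrightarrow> puiseux_size \<delta> < d \<Longrightarrow> \<alpha> + \<delta> \<in> U"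
    "\<And>\<delta>. \<delta> \<in> puiseux_valring \<Longrightarrow> puiseux_size \<delta> < d \<Longrightarrow> puiseux_ord_ge (\<phi> (\<alpha> + \<delta>)) r"
proof -
  from bounded[unfolded puiseux_lojasiewicz_bounded_def, THEN bspec, OF assms]
  obtain V K L where V: "openin (top_of_set U) V" "\<alpha> \<in> V"
    and ord: "\<forall>\<xi>\<in>V. real (puiseux_mult (\<phi> \<xi>)) \<le> K * real (puiseux_mult \<xi>) \<and>
                puiseux_order (\<phi> \<xi>) \<ge> - ereal L"
    by (elim exE conjE)
  have "openin (top_of_set puiseux_valring) V" using V(1) U_open by (rule openin_trans)
  then obtain d where d: "d > 0" "\<And>\<xi>. \<xi> \<in> puiseux_valring \<Longrightarrow> dist \<xi> \<alpha> < d \<Longrightarrow> \<xi> \<in> V"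
    using V(2) unfolding openin_euclidean_subtopology_iff by meson
  \<comment> \<open>Exponents are rational while \<open>L\<close> is real, hence a rational below
    \<open>- L\<close>.\<close>
  obtain r :: rat where r: "of_rat r < - L" using of_rat_dense[of "- L - 1" "- L"] by auto
  have *: "\<alpha> + \<delta> \<in> V" if "\<delta> \<in> puiseux_valring" "puiseux_size \<delta> < d" for \<delta>
    using that d(2)[OF puiseux_valring_add[OF U_valring[OF assms]]] by (simp add: dist_puiseux_def)
  show ?thesis
  proof (rule that[of d r])
    fix \<delta> assume "\<delta> \<in> puiseux_valring" "puiseux_size \<delta> < d"
    note V' = *[OF this]
    from V' show "\<alpha> + \<delta> \<in> U" using openin_imp_subset[OF V(1)] by blast
    show "puiseux_ord_ge (\<phi> (\<alpha> + \<delta>)) r"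
      using bspec[OF ord V'] r
      by (intro puiseux_order_geD[of "- L"]) auto
  qed (use d in auto)
qed

text \<open>Convergence of the quotients alone does not give convergence after multiplication by
  \<eta>. The order bound supplies what is missing: each coefficient of the product involves only a
  finite set of exponents that is the same for all small t.\<close>

lemma coeff_deriv_at_0:
  assumes \<alpha>: "\<alpha> \<in> U" and \<eta>: "\<eta> \<in> puiseux_valring"
  shows "((\<lambda>t. puiseux_coeff (\<phi> (\<alpha> + puiseux_const t * \<eta>)) q)
           has_field_derivative puiseux_coeff (\<phi>' \<alpha> * \<eta>) q) (at 0)"
proof (cases "\<eta> = 0")
  case True
  then show ?thesis by (simp add: coeff_puiseux_simps)
next
  case False
  then obtain w where w: "puiseux_coeff \<eta> w \<noteq> 0" "puiseux_ord_ge \<eta> w"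
    by (rule puiseux_leading_exponent)
  obtain d r where d: "d > 0" "\<And>\<delta>. \<delta> \<in> puiseux_valring \<Longrightarrow> puiseux_size \<delta> < d \<Longrightarrow> \<alpha> + \<delta> \<in> U"
    "\<And>\<delta>. \<delta> \<in> puiseux_valring \<Longrightarrow> puiseux_size \<delta> < d \<Longrightarrow> puiseux_ord_ge (\<phi> (\<alpha> + \<delta>)) r"
    using local_ball[OF \<alpha>] by blast
  define Q where "Q = (\<lambda>t. (\<phi> (\<alpha> + puiseux_const t * \<eta>) - \<phi> \<alpha>) / (puiseux_const t * \<eta>))"
  have lim0: "((\<lambda>t. puiseux_const t * \<eta>) \<longlongrightarrow> 0) (at 0)"
  proof (rule tendstoI)
    fix e :: real assume "e > 0"
    then obtain s where "s > 0" "\<And>c. norm c < s \<Longrightarrow> puiseux_size (puiseux_const c * \<eta>) < e"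
      using puiseux_size_const_mult_small by blast
    then show "\<forall>\<^sub>F t in at 0. dist (puiseux_const t * \<eta>) 0 < e"
      unfolding eventually_at by (auto simp: dist_puiseux_def)
  qed
  have "filterlim (\<lambda>t. puiseux_const t * \<eta>) (at 0 within puiseux_valring) (at 0)"
    unfolding filterlim_at using lim0 \<eta> False
    by (auto simp: eventually_at puiseux_valring_const_mult intro: exI[of _ 1])
  then have Q: "(Q \<longlongrightarrow> \<phi>' \<alpha>) (at 0)"
    unfolding Q_def by (rule filterlim_compose[OF has_deriv[OF \<alpha>]])
  \<comment> \<open>At \<open>t = 0\<close> both sides are 0 by the convention for division by
    zero.\<close>
  have Q_mult: "Q t * \<eta> = puiseux_const (1 / t) * (\<phi> (\<alpha> + puiseux_const t * \<eta>) - \<phi> \<alpha>)" for t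
    using False by (cases "t = 0") (simp_all add: Q_def puiseux_const_divide field_simps)
  \<comment> \<open>The numerator has order at least \<open>r\<close>, and dividing by \<eta> costs
    its leading exponent \<open>w\<close>.\<close>
  have ordQ: "\<forall>\<^sub>F t in at 0. puiseux_ord_ge (Q t) (r - w)"
  proof -
    have "puiseux_ord_ge (\<phi> \<alpha>) r"
      using d(1) d(3)[of 0] by (simp add: puiseux_valring_iff puiseux_ord_ge_def coeff_puiseux_zero)
    moreover have "\<forall>\<^sub>F t in at 0. puiseux_ord_ge (\<phi> (\<alpha> + puiseux_const t * \<eta>)) r"
      using tendstoD[OF lim0 d(1)]
      by eventually_elim (intro d(3) puiseux_valring_const_mult \<eta>; simp add: dist_puiseux_def)
    ultimately have "\<forall>\<^sub>F t in at 0. puiseux_ord_ge (\<eta> * Q t) r"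
      unfolding mult.commute[of \<eta>] Q_mult
      by (auto elim!: eventually_mono intro!: puiseux_ord_ge_const_mult puiseux_ord_ge_diff)
    then show ?thesis by eventually_elim (rule puiseux_ord_ge_cancel[OF _ w])
  qed
  have ord': "puiseux_ord_ge (\<phi>' \<alpha>) (r - w)"
    unfolding puiseux_ord_ge_def
  proof (intro allI impI)
    fix p assume p: "p < r - w"
    have "\<forall>\<^sub>F t in at 0. puiseux_coeff (Q t) p = 0"
      using ordQ by eventually_elim (use p in \<open>auto simp: puiseux_ord_ge_def\<close>)
    then have "((\<lambda>t. puiseux_coeff (Q t) p) \<longlongrightarrow> 0) (at 0)" by (rule tendsto_eventually)
    with tendsto_coeff_puiseux[OF Q] show "puiseux_coeff (\<phi>' \<alpha>) p = 0"
      by (intro tendsto_unique[of "at (0 :: complex)"]) auto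
  qed
  \<comment> \<open>The exponents p that can contribute: p is bounded below by the order of the
    quotient and above because \<eta> has a leading exponent. The parameter t does not
    occur.\<close>
  define A where "A = {p. puiseux_coeff \<eta> (q - p) \<noteq> 0 \<and> p \<ge> r - w}"
  have "A \<subseteq> (\<lambda>p. q - p) ` {p. puiseux_coeff \<eta> p \<noteq> 0 \<and> p \<le> q - (r - w)}"
  proof
    fix p assume "p \<in> A"
    then show "p \<in> (\<lambda>p. q - p) ` {p. puiseux_coeff \<eta> p \<noteq> 0 \<and> p \<le> q - (r - w)}"
      by (intro image_eqI[of _ _ "q - p"]) (auto simp: A_def)
  qed
  then have A: "finite A" using puiseux_finite_below by (rule finite_surj[rotated])
  have prod: "puiseux_coeff (x * \<eta>) q = (\<Sum>p\<in>A. puiseux_coeff x p * puiseux_coeff \<eta> (q - p))"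
    if "puiseux_ord_ge x (r - w)" for x
    using that by (intro coeff_puiseux_mult A) (auto simp: A_def puiseux_ord_ge_def not_le[symmetric])
  have "((\<lambda>t. \<Sum>p\<in>A. puiseux_coeff (Q t) p * puiseux_coeff \<eta> (q - p))
      \<longlongrightarrow> (\<Sum>p\<in>A. puiseux_coeff (\<phi>' \<alpha>) p * puiseux_coeff \<eta> (q - p))) (at 0)"
    by (intro tendsto_intros tendsto_coeff_puiseux Q)
  also have "(\<Sum>p\<in>A. puiseux_coeff (\<phi>' \<alpha>) p * puiseux_coeff \<eta> (q - p)) = puiseux_coeff (\<phi>' \<alpha> * \<eta>) q"
    by (rule prod[OF ord', symmetric])
  finally have "((\<lambda>t. puiseux_coeff (Q t * \<eta>) q) \<longlongrightarrow> puiseux_coeff (\<phi>' \<alpha> * \<eta>) q) (at 0)"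
    by (rule Lim_transform_eventually) (use ordQ in \<open>auto elim!: eventually_mono simp: prod\<close>)
  then show ?thesis
    unfolding has_field_derivative_iff Q_mult by (simp add: coeff_puiseux_simps)
qed

lemma coeff_deriv:
  assumes "\<alpha> + puiseux_const t * \<eta> \<in> U" "\<eta> \<in> puiseux_valring"
  shows "((\<lambda>t. puiseux_coeff (\<phi> (\<alpha> + puiseux_const t * \<eta>)) q)
           has_field_derivative puiseux_coeff (\<phi>' (\<alpha> + puiseux_const t * \<eta>) * \<eta>) q) (at t)"
  using coeff_deriv_at_0[OF assms, of q]
    DERIV_shift[of "\<lambda>t. puiseux_coeff (\<phi> (\<alpha> + puiseux_const t * \<eta>)) q" _ 0 t]
  by (simp add: puiseux_const_add algebra_simps)

end

section \<open>Polynomials of bounded growth and non-integral fractions\<close>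

text \<open>By Liouville's theorem the function is a polynomial of degree at most m, and a
  polynomial function determines its coefficients.\<close>

lemma polynomial_growth_coeff_zero:
  fixes c :: "nat \<Rightarrow> complex"
  assumes bound: "\<And>z. z \<noteq> 0 \<Longrightarrow> norm (\<Sum>k<n. c k * z ^ k) \<le> B * norm z ^ m"
    and k: "m < k" "k < n"
  shows "c k = 0"
proof -
  define f where "f = (\<lambda>z. \<Sum>k<n. c k * z ^ k)"
  define b where "b = (\<lambda>k. (deriv ^^ k) f 0 / fact k)"
  have f: "f z = (\<Sum>k\<le>m. b k * z ^ k)" for z
    unfolding b_def
  proof (rule Liouville_polynomial)
    show "f holomorphic_on UNIV" unfolding f_def by (intro holomorphic_intros)
    show "norm (f w) \<le> B * norm w ^ m" if "1 \<le> norm w" for w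
      unfolding f_def using that by (intro bound) auto
  qed
  \<comment> \<open>Both polynomials are padded with zeros to one index range, as comparison of
    coefficients requires.\<close>
  have "(\<Sum>j\<le>n. (if j < n then c j else 0) * z ^ j) = (\<Sum>j\<le>n. (if j \<le> m then b j else 0) * z ^ j)" for z
  proof -
    have "(\<Sum>j\<le>n. (if j < n then c j else 0) * z ^ j) = f z"
      unfolding f_def by (rule sum.mono_neutral_cong_right) auto
    also have "\<dots> = (\<Sum>j\<le>n. (if j \<le> m then b j else 0) * z ^ j)"
      unfolding f using k by (intro sum.mono_neutral_cong_left) auto
    finally show ?thesis .
  qed
  then have "\<forall>j\<le>n. (if j < n then c j else 0) = (if j \<le> m then b j else 0)"
    by (intro iffD1[OF polyfun_eq_coeffs[where n = n and
          c = "\<lambda>j. if j < n then c j else 0" and d = "\<lambda>j. if j \<le> m then b j else 0"]] allI)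
  then show ?thesis using k by (metis less_imp_le not_le)
qed

lemma of_int_divide_notin_Ints:
  fixes a b :: int
  assumes "0 < \<bar>a\<bar>" "\<bar>a\<bar> < b"
  shows "(of_int a / of_int b :: rat) \<notin> \<int>"
proof
  assume "(of_int a / of_int b :: rat) \<in> \<int>"
  then obtain k where "(of_int a / of_int b :: rat) = of_int k" by (auto elim: Ints_cases)
  then have "(of_int a :: rat) = of_int (k * b)" using assms by (simp add: field_simps)
  then have "a = k * b" by (simp only: of_int_eq_iff)
  then have "b dvd a" by simp
  with assms show False using zdvd_not_zless[of "\<bar>a\<bar>" b] by auto
qed

context puiseux_differentiable
begin

text \<open>
  Both partial derivatives of \<open>\<phi> (\<alpha> + z \<eta> + t y\<^sup>m \<eta>)\<close> are multiples of the same value of \<open>\<phi>'\<close>, so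
  the \<open>t\<close>-derivative of the coefficient at \<open>q\<close> is the \<open>z\<close>-derivative of the coefficient at \<open>q - m\<close>.
  This recursion stops at the order bound \<open>r\<close>, which is why the coefficients are polynomial in \<open>t\<close>.
\<close>

lemma taylor_shift:
  assumes \<eta>: "\<eta> \<in> puiseux_valring" and m: "m \<ge> 0"
    and dom: "\<And>z t. norm z < \<rho> \<Longrightarrow> norm t < \<tau> \<Longrightarrow>
        \<alpha> + puiseux_const z * \<eta> + puiseux_const t * (puiseux_monom m * \<eta>) \<in> U"
    and ord: "\<And>z t. norm z < \<rho> \<Longrightarrow> norm t < \<tau> \<Longrightarrow>
        puiseux_ord_ge (\<phi> (\<alpha> + puiseux_const z * \<eta> + puiseux_const t * (puiseux_monom m * \<eta>))) r"
    and "norm z < \<rho>" "norm t < \<tau>" "q < r + of_nat n * m"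
  shows "puiseux_coeff (\<phi> (\<alpha> + puiseux_const z * \<eta> + puiseux_const t * (puiseux_monom m * \<eta>))) q
     = (\<Sum>k<n. t ^ k / fact k *
          (deriv ^^ k) (\<lambda>z. puiseux_coeff (\<phi> (\<alpha> + puiseux_const z * \<eta>)) (q - of_nat k * m)) z)"
  using assms(5-7)
proof (induction n arbitrary: q z t)
  \<comment> \<open>The sum is empty, and \<open>q\<close> lies below the order bound
    \<open>r\<close>.\<close>
  case 0
  then show ?case using puiseux_ord_geD[OF ord] by simp
next
  case (Suc n)
  define g where "g = (\<lambda>q z. puiseux_coeff (\<phi> (\<alpha> + puiseux_const z * \<eta>)) q)"
  define \<xi> where "\<xi> = (\<lambda>z t. \<alpha> + puiseux_const z * \<eta> + puiseux_const t * (puiseux_monom m * \<eta>))"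
  have \<tau>: "\<tau> > 0" using Suc.prems(2) norm_ge_zero order_le_less_trans by blast
  have m\<eta>: "puiseux_monom m * \<eta> \<in> puiseux_valring"
    using \<eta> m by (intro puiseux_valring_mult puiseux_valring_monom)
  have hol: "g q holomorphic_on ball 0 \<rho>" for q
    unfolding holomorphic_on_def
  proof
    fix z :: complex assume "z \<in> ball 0 \<rho>"
    then have "\<alpha> + puiseux_const z * \<eta> \<in> U" using dom[of z 0] \<tau> by simp
    from coeff_deriv[OF this \<eta>, of q] show "g q field_differentiable at z within ball 0 \<rho>"
      unfolding g_def field_differentiable_def using has_field_derivative_at_within by blast
  qed
  have derivg: "((deriv ^^ k) (g q) has_field_derivative (deriv ^^ Suc k) (g q) z) (at z)"
    if "norm z < \<rho>" for k q z
    using holomorphic_derivI[OF holomorphic_higher_deriv[OF hol, of k q] _ , of z] that by simp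
  have dt: "((\<lambda>t. puiseux_coeff (\<phi> (\<xi> z t)) q) has_field_derivative
        puiseux_coeff (\<phi>' (\<xi> z t) * \<eta>) (q - m)) (at t)" if "norm z < \<rho>" "norm t < \<tau>" for z t q
    using coeff_deriv[OF dom[OF that, folded add.assoc] m\<eta>, of q]
    by (simp add: \<xi>_def coeff_puiseux_monom_mult mult.left_commute[of _ "puiseux_monom m"])
  have dz: "((\<lambda>z. puiseux_coeff (\<phi> (\<xi> z t)) q) has_field_derivative
        puiseux_coeff (\<phi>' (\<xi> z t) * \<eta>) q) (at z)" if "norm z < \<rho>" "norm t < \<tau>" for z t q
    using coeff_deriv[of "\<alpha> + puiseux_const t * (puiseux_monom m * \<eta>)" z \<eta> q] \<eta> dom[OF that]
    by (simp add: \<xi>_def add.assoc add.commute[of "puiseux_const t * _"])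
  have IH: "puiseux_coeff (\<phi> (\<xi> z t)) (q - m)
      = (\<Sum>k<n. t ^ k / fact k * (deriv ^^ k) (g (q - of_nat (Suc k) * m)) z)"
    if "norm z < \<rho>" "norm t < \<tau>" for z t
    using Suc.IH[OF that, of "q - m"] Suc.prems(3) by (simp add: \<xi>_def g_def algebra_simps)
  \<comment> \<open>Differentiating the induction hypothesis in z evaluates the common factor of
    both partial derivatives; this is why the induction is over all z in the disc.\<close>
  have eq: "puiseux_coeff (\<phi>' (\<xi> z t) * \<eta>) (q - m)
      = (\<Sum>k<n. t ^ k / fact k * (deriv ^^ Suc k) (g (q - of_nat (Suc k) * m)) z)"
    if "norm z < \<rho>" "norm t < \<tau>" for z t
  proof (rule DERIV_unique)
    show "((\<lambda>z. \<Sum>k<n. t ^ k / fact k * (deriv ^^ k) (g (q - of_nat (Suc k) * m)) z)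
        has_field_derivative puiseux_coeff (\<phi>' (\<xi> z t) * \<eta>) (q - m)) (at z)"
      by (rule has_field_derivative_transform_within_open[OF dz[OF that], of "ball 0 \<rho>"])
         (use that IH in auto)
    show "((\<lambda>z. \<Sum>k<n. t ^ k / fact k * (deriv ^^ k) (g (q - of_nat (Suc k) * m)) z)
        has_field_derivative (\<Sum>k<n. t ^ k / fact k * (deriv ^^ Suc k) (g (q - of_nat (Suc k) * m)) z)) (at z)"
      by (intro DERIV_sum DERIV_cmult derivg that)
  qed
  \<comment> \<open>The remainder as a function of t. Its derivative vanishes on the disc by
    \<open>eq\<close>, and at t = 0 only the summand k = 0 is left, which equals the coefficient
    itself.\<close>
  define D where "D = (\<lambda>t. puiseux_coeff (\<phi> (\<xi> z t)) q
      - (\<Sum>k<Suc n. t ^ k / fact k * (deriv ^^ k) (g (q - of_nat k * m)) z))"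
  have "\<exists>c. \<forall>t\<in>ball 0 \<tau>. D t = c"
  proof (rule has_field_derivative_zero_constant)
    fix t :: complex assume t: "t \<in> ball 0 \<tau>"
    have "((\<lambda>t. \<Sum>k<Suc n. t ^ k / fact k * (deriv ^^ k) (g (q - of_nat k * m)) z)
        has_field_derivative (\<Sum>k<Suc n. of_nat k * t ^ (k - 1) / fact k
            * (deriv ^^ k) (g (q - of_nat k * m)) z)) (at t)"
      by (intro DERIV_sum) (auto intro!: derivative_eq_intros)
    also have "(\<Sum>k<Suc n. of_nat k * t ^ (k - 1) / fact k * (deriv ^^ k) (g (q - of_nat k * m)) z)
        = (\<Sum>k<n. of_nat (Suc k) * t ^ k / fact (Suc k) * (deriv ^^ Suc k) (g (q - of_nat (Suc k) * m)) z)"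
      by (subst sum.lessThan_Suc_shift) simp
    also have "\<dots> = (\<Sum>k<n. t ^ k / fact k * (deriv ^^ Suc k) (g (q - of_nat (Suc k) * m)) z)"
      by (intro sum.cong refl) (simp del: of_nat_Suc funpow.simps add: fact_Suc)
    also have "\<dots> = puiseux_coeff (\<phi>' (\<xi> z t) * \<eta>) (q - m)"
      using eq[OF Suc.prems(1), of t] t by simp
    finally have "(D has_field_derivative 0) (at t)"
      unfolding D_def using DERIV_diff[OF dt[OF Suc.prems(1), of t q]] t by fastforce
    then show "(D has_field_derivative 0) (at t within ball 0 \<tau>)"
      by (rule has_field_derivative_at_within)
  qed auto
  then have "D t = D 0" using Suc.prems(2) \<tau> by force
  also have "D 0 = 0"
    unfolding D_def by (subst sum.lessThan_Suc_shift) (simp add: \<xi>_def g_def)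
  finally show ?case by (simp add: D_def \<xi>_def g_def)
qed

section \<open>Consequences of convergence of the difference quotients\<close>

text \<open>One radius \<open>d\<close> controls domain, order and quotients, and \<zeta> is so
  small that T \<zeta> uses at most half of it for every T. The other half leaves room for a
  perturbation whose scale is fixed before T, which yields a constant valid for all T.\<close>

lemma difference_quotient_growth_bound:
  assumes \<alpha>: "\<alpha> \<in> U"
    and dom: "\<And>\<delta>. \<delta> \<in> puiseux_valring \<Longrightarrow> puiseux_size \<delta> < d \<Longrightarrow> \<alpha> + \<delta> \<in> U"
    and ord: "\<And>\<delta>. \<delta> \<in> puiseux_valring \<Longrightarrow> puiseux_size \<delta> < d \<Longrightarrow> puiseux_ord_ge (\<phi> (\<alpha> + \<delta>)) r"
    and quot: "\<And>\<delta>. \<delta> \<in> puiseux_valring \<Longrightarrow> \<delta> \<noteq> 0 \<Longrightarrow> puiseux_size \<delta> < d \<Longrightarrow>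
                 puiseux_size ((\<phi> (\<alpha> + \<delta>) - \<phi> \<alpha>) / \<delta> - \<phi>' \<alpha>) < 1"
    and \<zeta>: "\<zeta> \<in> puiseux_valring" "\<zeta> \<noteq> 0" "\<And>T. puiseux_size (puiseux_const T * \<zeta>) < d / 2"
  obtains C where "\<And>T. T \<noteq> 0 \<Longrightarrow> norm (puiseux_coeff (puiseux_const T *
      (\<phi>' (\<alpha> + puiseux_const T * \<zeta>) * \<zeta>) - \<phi> (\<alpha> + puiseux_const T * \<zeta>) + \<phi> \<alpha>) q) \<le> C * norm T ^ 2"
proof -
  have d: "d > 0" using order_le_less_trans[OF puiseux_size_nonneg \<zeta>(3)[of 0]] by simp
  obtain w where w: "puiseux_coeff \<zeta> w \<noteq> 0" "puiseux_ord_ge \<zeta> w"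
    using \<zeta>(2) by (rule puiseux_leading_exponent)
  have w0: "w \<ge> 0" using \<zeta>(1) w(1) unfolding puiseux_valring_iff by (meson not_le puiseux_ord_geD)
  have \<zeta>2: "\<zeta> ^ 2 \<in> puiseux_valring"
    unfolding power2_eq_square by (intro puiseux_valring_mult \<zeta>)
  \<comment> \<open>Chosen so that q + p + 1 is at most r + 2 p - w: the exponents
    \<open>q + e j\<close> then stay below the order of the second-order remainder.\<close>
  define p where "p = nat \<lceil>q + 1 - r + w\<rceil> + 1"
  have p: "q + 1 - r + w \<le> of_nat p" "p \<ge> 1" unfolding p_def by linarith+
  \<comment> \<open>A coefficient of modulus at least 1 contributes at least half of its weight, and
    the exponents used are below q + p + 1. Hence J such coefficients give a size of at least J /
    2^(q + p + 2), which exceeds 1.\<close>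
  obtain J :: nat where J: "2 powr (of_rat q + real p + 2) < real J"
    using reals_Archimedean2 by blast
  have J0: "J > 0" using order_less_trans[OF _ J, of 0] by simp
  \<comment> \<open>The J shifted copies of c \<zeta>^2 then have total size below d / 8. The
    estimate does not involve the shifts, which are chosen only after T.\<close>
  obtain \<rho> where \<rho>: "\<rho> > 0"
      "\<And>c. norm c < \<rho> \<Longrightarrow> puiseux_size (puiseux_const c * \<zeta> ^ 2) < d / (8 * real J)"
    using puiseux_size_const_mult_small[of "d / (8 * real J)" "\<zeta> ^ 2"] d J0 by auto
  define s where "s = \<rho> / 2"
  have s: "s > 0" "s < \<rho>" using \<rho> by (auto simp: s_def)
  show ?thesis
  proof (rule that[of "1 / s"])
    fix T :: complex assume T: "T \<noteq> 0"
    define W where "W = puiseux_const T * \<zeta>"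
    define H where "H = puiseux_const T * (\<phi>' (\<alpha> + W) * \<zeta>) - \<phi> (\<alpha> + W) + \<phi> \<alpha>"
    define f where "f = (\<lambda>\<delta>. (\<phi> (\<alpha> + \<delta>) - \<phi> \<alpha>) / \<delta> - \<phi>' \<alpha>)"
    have W0: "W \<noteq> 0" using \<zeta> T by (simp add: W_def)
    have W: "W \<in> puiseux_valring" "puiseux_size W < d / 2"
      using \<zeta> by (auto simp: W_def puiseux_valring_const_mult)
    have WU: "\<alpha> + W \<in> U" using W d by (intro dom) auto
    have ord_H: "puiseux_ord_ge H r"
    proof -
      \<comment> \<open>Below \<open>r\<close> the coefficients of \<phi> vanish identically along
        this line, so their derivatives vanish as well.\<close>
      have "puiseux_ord_ge (\<phi>' (\<alpha> + W) * \<zeta>) r"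
        unfolding puiseux_ord_ge_def
      proof (intro allI impI)
        fix q' assume q': "q' < r"
        have "puiseux_coeff (\<phi> (\<alpha> + W + puiseux_const t * \<zeta>)) q' = 0" for t
        proof -
          have "\<alpha> + W + puiseux_const t * \<zeta> = \<alpha> + puiseux_const (T + t) * \<zeta>"
            by (simp add: W_def puiseux_const_add algebra_simps)
          moreover have "puiseux_ord_ge (\<phi> (\<alpha> + puiseux_const (T + t) * \<zeta>)) r"
            using \<zeta>(3)[of "T + t"] d by (intro ord puiseux_valring_const_mult \<zeta>) auto
          ultimately show ?thesis using q' by (metis puiseux_ord_geD)
        qed
        then have "((\<lambda>t. puiseux_coeff (\<phi> (\<alpha> + W + puiseux_const t * \<zeta>)) q') has_field_derivative 0) (at 0)"
          by simp
        with coeff_deriv_at_0[OF WU \<zeta>(1), of q'] show "puiseux_coeff (\<phi>' (\<alpha> + W) * \<zeta>) q' = 0"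
          by (rule DERIV_unique)
      qed
      moreover have "puiseux_ord_ge (\<phi> (\<alpha> + W)) r" using W d by (intro ord) auto
      moreover have "puiseux_ord_ge (\<phi> \<alpha>) r"
        using ord[of 0] d by (simp add: puiseux_valring_iff puiseux_ord_ge_def coeff_puiseux_zero)
      ultimately show ?thesis unfolding H_def
        by (intro puiseux_ord_ge_add puiseux_ord_ge_diff puiseux_ord_ge_const_mult)
    qed
    obtain M1 where M1: "M1 > 0" "\<And>q. puiseux_coeff H q \<noteq> 0 \<Longrightarrow> q * of_nat M1 \<in> \<int>"
      using puiseux_common_denominator by blast
    obtain M2 where M2: "M2 > 0" "\<And>q. puiseux_coeff (f W) q \<noteq> 0 \<Longrightarrow> q * of_nat M2 \<in> \<int>"
      using puiseux_common_denominator by blast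
    obtain M3 where M3: "M3 > 0" "\<And>q'. puiseux_coeff (puiseux_monom q) q' \<noteq> 0 \<Longrightarrow> q' * of_nat M3 \<in> \<int>"
      using puiseux_common_denominator by blast
    define M where "M = M1 * M2 * M3"
    have M: "M > 0" using M1 M2 M3 by (simp add: M_def)
    have MH: "q * of_nat M \<in> \<int>" if "puiseux_coeff H q \<noteq> 0" for q
      using Ints_mult[OF M1(2)[OF that] Ints_of_nat[of "M2 * M3"]] by (simp add: M_def mult_ac)
    have Mf: "q * of_nat M \<in> \<int>" if "puiseux_coeff (f W) q \<noteq> 0" for q
      using Ints_mult[OF M2(2)[OF that] Ints_of_nat[of "M1 * M3"]] by (simp add: M_def mult_ac)
    have Mq: "q * of_nat M \<in> \<int>"
      using Ints_mult[OF M3(2)[of q] Ints_of_nat[of "M1 * M2"]]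
      by (simp add: M_def mult_ac coeff_puiseux_monom)
    \<comment> \<open>The exponents \<open>e j\<close> are pairwise incongruent, and incongruent to 0, modulo \<open>1 / M\<close>: the \<open>J\<close> copies
      of \<open>H\<close> in \<open>P0 * H\<close> then overlap neither with each other nor with \<open>f W\<close>.\<close>
    define e where "e = (\<lambda>j :: nat. of_nat p + of_nat (Suc j) / (of_nat M * of_nat (Suc J)) :: rat)"
    have e: "of_nat p \<le> e j" "e j < of_nat p + 1" if "j < J" for j
    proof -
      have "Suc j < Suc J" using that by simp
      also have "\<dots> \<le> M * Suc J" using M by (cases M) simp_all
      finally have "(of_nat (Suc j) :: rat) < of_nat M * of_nat (Suc J)"
        by (simp only: of_nat_mult[symmetric] of_nat_less_iff)
      then have "(of_nat (Suc j) :: rat) / (of_nat M * of_nat (Suc J)) < 1"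
        using M by (simp add: divide_less_eq_1)
      then show "e j < of_nat p + 1" by (simp add: e_def)
      show "of_nat p \<le> e j" by (simp add: e_def)
    qed
    have e_M: "e j * of_nat M = of_nat (p * M) + of_int (int (Suc j)) / of_int (int (Suc J))" for j
      using M by (simp add: e_def distrib_right del: of_nat_Suc)
    have f_e: "puiseux_coeff (f W) (q + e j) = 0" if "j < J" for j
    proof (rule ccontr)
      assume "puiseux_coeff (f W) (q + e j) \<noteq> 0"
      then have "(q + e j) * of_nat M \<in> \<int>" by (rule Mf)
      then have "(q + e j) * of_nat M - q * of_nat M - of_nat (p * M) \<in> \<int>"
        by (intro Ints_diff Mq Ints_of_nat)
      also have "(q + e j) * of_nat M - q * of_nat M - of_nat (p * M)
          = of_int (int (Suc j)) / of_int (int (Suc J))"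
        unfolding distrib_right e_M by simp
      finally show False using of_int_divide_notin_Ints[of "int (Suc j)" "int (Suc J)"] that by auto
    qed
    have H_e: "puiseux_coeff H (q + e j - e i) = 0" if "i \<noteq> j" "i < J" "j < J" for i j
    proof (rule ccontr)
      assume "puiseux_coeff H (q + e j - e i) \<noteq> 0"
      then have "(q + e j - e i) * of_nat M \<in> \<int>" by (rule MH)
      then have "(q + e j - e i) * of_nat M - q * of_nat M \<in> \<int>"
        by (intro Ints_diff Mq)
      also have "(q + e j - e i) * of_nat M - q * of_nat M
          = of_int (int j - int i) / of_int (int (Suc J))"
        unfolding distrib_right left_diff_distrib e_M by (simp add: diff_divide_distrib[symmetric])
      finally have "of_int (int j - int i) / of_int (int (Suc J)) \<in> (\<int> :: rat set)" .
      moreover have "0 < \<bar>int j - int i\<bar>" "\<bar>int j - int i\<bar> < int (Suc J)" using that by auto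
      ultimately show False using of_int_divide_notin_Ints by blast
    qed
    define P0 where "P0 = (\<Sum>j<J. puiseux_monom (e j))"
    define P where "P = \<zeta> ^ 2 * P0"
    have P0: "puiseux_ord_ge P0 (of_nat p)"
      unfolding P0_def using e by (intro puiseux_ord_ge_sum puiseux_ord_ge_monom) auto
    have P0_val: "P0 \<in> puiseux_valring"
      using P0 unfolding puiseux_valring_iff by (rule puiseux_ord_ge_mono) simp
    have P_val: "P \<in> puiseux_valring" unfolding P_def by (intro puiseux_valring_mult P0_val \<zeta>2)
    have size_P: "puiseux_size (puiseux_const c * P) < d / 8" if "norm c < \<rho>" for c
    proof -
      have "puiseux_const c * P = (\<Sum>j<J. puiseux_monom (e j) * (puiseux_const c * \<zeta> ^ 2))"
        by (simp add: P_def P0_def sum_distrib_left mult_ac)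
      also have "puiseux_size \<dots> \<le> (\<Sum>j<J. puiseux_size (puiseux_monom (e j) * (puiseux_const c * \<zeta> ^ 2)))"
        by (rule puiseux_size_sum_triangle)
      also have "\<dots> \<le> (\<Sum>j<J. puiseux_size (puiseux_const c * \<zeta> ^ 2))"
        by (intro sum_mono puiseux_size_monom_mult_le) (use e in \<open>force intro: order_trans\<close>)
      also have "\<dots> = real J * puiseux_size (puiseux_const c * \<zeta> ^ 2)" by simp
      also have "\<dots> < real J * (d / (8 * real J))"
        using \<rho>(2)[OF that] J0 by (intro mult_strict_left_mono) auto
      also have "\<dots> = d / 8" using J0 by simp
      finally show ?thesis .
    qed
    define sP where "sP = puiseux_const (of_real s) * P"
    have sP: "sP \<in> puiseux_valring" "puiseux_size sP < d / 8"
      unfolding sP_def using P_val size_P[of "of_real s"] s by (auto intro: puiseux_valring_const_mult)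
    define \<delta> where "\<delta> = W + sP"
    have \<delta>: "\<delta> \<in> puiseux_valring" "puiseux_size \<delta> < d"
      unfolding \<delta>_def using W sP d puiseux_size_triangle[of W sP] by (auto intro: puiseux_valring_add)
    have ord_P: "puiseux_ord_ge P (w + w + of_nat p)"
      unfolding P_def power2_eq_square by (intro puiseux_ord_ge_mult w P0)
    \<comment> \<open>Because \<open>p\<close> is positive and \<open>w\<close> nonnegative, the
      perturbation starts strictly above \<open>w\<close>: the leading term of \<delta> is that of
      \<open>W\<close>.\<close>
    have \<delta>_w: "puiseux_coeff \<delta> w \<noteq> 0" "puiseux_ord_ge \<delta> w"
    proof -
      have "w < w + w + of_nat p" using w0 p(2) by simp
      then have "puiseux_coeff P w = 0" using puiseux_ord_geD[OF ord_P] by blast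
      then show "puiseux_coeff \<delta> w \<noteq> 0"
        using w T by (simp add: \<delta>_def W_def sP_def coeff_puiseux_simps)
      have "puiseux_ord_ge P w" using ord_P by (rule puiseux_ord_ge_mono) (use w0 in simp)
      then show "puiseux_ord_ge \<delta> w" unfolding \<delta>_def W_def sP_def
        by (intro puiseux_ord_ge_add puiseux_ord_ge_const_mult w)
    qed
    then have \<delta>0: "\<delta> \<noteq> 0" by (auto simp: coeff_puiseux_zero)
    define E where "E = \<phi> (\<alpha> + \<delta>) - \<phi> (\<alpha> + W) - puiseux_const (of_real s) * (\<phi>' (\<alpha> + W) * P)"
    have ord_E: "puiseux_ord_ge E (r + 2 * of_nat p)"
      unfolding puiseux_ord_ge_def
    proof (intro allI impI)
      fix q' :: rat assume q': "q' < r + 2 * of_nat p"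
      \<comment> \<open>Writing P as y^p \<eta> makes the shifted Taylor expansion applicable with m
        = p. Below r + 2 p it stops after two terms, the value and the first derivative, and these
        are subtracted in \<open>E\<close>.\<close>
      define \<eta> where "\<eta> = puiseux_monom (- of_nat p) * P"
      have P_\<eta>: "puiseux_monom (of_nat p) * \<eta> = P"
        by (rule puiseux_eqI) (simp add: \<eta>_def coeff_puiseux_monom_mult)
      have \<eta>: "\<eta> \<in> puiseux_valring"
        using ord_P w0 by (auto simp: \<eta>_def puiseux_valring_iff puiseux_ord_ge_def coeff_puiseux_monom_mult)
      \<comment> \<open>This radius may depend on T, since only derivatives in z at 0 enter.\<close>
      obtain \<sigma> where \<sigma>: "\<sigma> > 0" "\<And>c. norm c < \<sigma> \<Longrightarrow> puiseux_size (puiseux_const c * \<eta>) < d / 8"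
        using puiseux_size_const_mult_small[of "d / 8" \<eta>] d by auto
      have in_ball: "W + puiseux_const z * \<eta> + puiseux_const t * P \<in> puiseux_valring"
          "puiseux_size (W + puiseux_const z * \<eta> + puiseux_const t * P) < d"
        if "norm z < \<sigma>" "norm t < \<rho>" for z t
        using W(2) \<sigma>(2)[OF that(1)] size_P[OF that(2)] d
          puiseux_size_triangle[of W "puiseux_const z * \<eta>"]
          puiseux_size_triangle[of "W + puiseux_const z * \<eta>" "puiseux_const t * P"]
        by (auto intro!: puiseux_valring_add W puiseux_valring_const_mult \<eta> P_val)
      have 1: "puiseux_coeff (\<phi> (\<alpha> + \<delta>)) q' = (\<Sum>k<2. of_real s ^ k / fact k *
          (deriv ^^ k) (\<lambda>z. puiseux_coeff (\<phi> (\<alpha> + W + puiseux_const z * \<eta>)) (q' - of_nat k * of_nat p)) 0)"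
        using taylor_shift[of \<eta> "of_nat p" \<sigma> \<rho> "\<alpha> + W" r 0 "of_real s" q' 2] \<eta> in_ball
          dom[OF in_ball] ord[OF in_ball] \<sigma>(1) s q'
        by (simp add: P_\<eta> add.assoc \<delta>_def sP_def)
      have 2: "deriv (\<lambda>z. puiseux_coeff (\<phi> (\<alpha> + W + puiseux_const z * \<eta>)) (q' - of_nat p)) 0
          = puiseux_coeff (\<phi>' (\<alpha> + W) * P) q'"
      proof -
        have "puiseux_coeff (\<phi>' (\<alpha> + W) * P) q' = puiseux_coeff (\<phi>' (\<alpha> + W) * \<eta>) (q' - of_nat p)"
          unfolding P_\<eta>[symmetric] mult.left_commute[of _ "puiseux_monom _"] coeff_puiseux_monom_mult ..
        with DERIV_imp_deriv[OF coeff_deriv_at_0[OF WU \<eta>, of "q' - of_nat p"]] show ?thesis by simp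
      qed
      show "puiseux_coeff E q' = 0"
        unfolding E_def using 1 2 by (simp add: numeral_2_eq_2 coeff_puiseux_simps)
    qed
    \<comment> \<open>\<open>R\<close> is the part of second order in \<open>P\<close>; as \<open>p\<close> is large, it does not reach the exponents \<open>q + e j\<close>.\<close>
    define R where "R = f \<delta> - f W - puiseux_const (of_real s / T ^ 2) * (P0 * H)"
    \<comment> \<open>After multiplication by \<delta> the terms of order zero and one in s that lie
      outside \<open>E\<close> cancel. What is left is \<open>E\<close> minus (s^2 / T^2) \<zeta>^2
      P0^2 H, and both parts have order at least r + 2 p.\<close>
    have "puiseux_ord_ge (\<delta> * R) (r + 2 * of_nat p)"
    proof -
      define c where "c = puiseux_const T"
      define x where "x = puiseux_const (of_real s)"
      have c0: "c \<noteq> 0" using T by (simp add: c_def)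
      have xc: "puiseux_const (of_real s / T ^ 2) = x / c ^ 2"
        by (simp add: c_def x_def puiseux_const_divide puiseux_const_power)
      have 1: "\<delta> * f \<delta> = \<phi> (\<alpha> + \<delta>) - \<phi> \<alpha> - \<phi>' \<alpha> * \<delta>"
        using \<delta>0 by (simp add: f_def field_simps)
      have 2: "W * f W = \<phi> (\<alpha> + W) - \<phi> \<alpha> - \<phi>' \<alpha> * W"
        using W0 by (simp add: f_def field_simps)
      have 3: "H = c * \<zeta> * (\<phi>' (\<alpha> + W) - f W - \<phi>' \<alpha>)"
        using 2 by (simp add: H_def W_def c_def algebra_simps)
      have "\<delta> * R = \<delta> * f \<delta> - W * f W - x * P * f W - x / c ^ 2 * (c * \<zeta>) * P0 * H - x * P * (x / c ^ 2 * (P0 * H))"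
        unfolding R_def xc by (simp add: \<delta>_def W_def sP_def c_def x_def algebra_simps add_divide_distrib)
      also have "x / c ^ 2 * (c * \<zeta>) * P0 * H = x * P * (\<phi>' (\<alpha> + W) - f W - \<phi>' \<alpha>)"
        unfolding 3 P_def using c0 by (simp add: field_simps power2_eq_square)
      also have "x * P * (x / c ^ 2 * (P0 * H)) = puiseux_const ((of_real s) ^ 2 / T ^ 2) * (\<zeta> ^ 2 * (P0 * P0 * H))"
        unfolding P_def x_def c_def puiseux_const_divide puiseux_const_power power2_eq_square
        by (simp add: mult_ac puiseux_const_mult)
      also have "\<delta> * f \<delta> - W * f W - x * P * f W - x * P * (\<phi>' (\<alpha> + W) - f W - \<phi>' \<alpha>)
          - puiseux_const ((of_real s) ^ 2 / T ^ 2) * (\<zeta> ^ 2 * (P0 * P0 * H))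
         = E - puiseux_const ((of_real s) ^ 2 / T ^ 2) * (\<zeta> ^ 2 * (P0 * P0 * H))"
        unfolding 1 2 E_def by (simp add: \<delta>_def sP_def x_def algebra_simps)
      also have "puiseux_ord_ge \<dots> (r + 2 * of_nat p)"
      proof (intro puiseux_ord_ge_diff ord_E puiseux_ord_ge_const_mult)
        have "puiseux_ord_ge (\<zeta> ^ 2 * (P0 * P0 * H)) (0 + (of_nat p + of_nat p + r))"
          using \<zeta>2 unfolding puiseux_valring_iff by (intro puiseux_ord_ge_mult P0 ord_H)
        then show "puiseux_ord_ge (\<zeta> ^ 2 * (P0 * P0 * H)) (r + 2 * of_nat p)"
          by (simp add: add.commute)
      qed
      finally show ?thesis .
    qed
    then have ord_R: "puiseux_ord_ge R (r + 2 * of_nat p - w)"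
      by (rule puiseux_ord_ge_cancel) (rule \<delta>_w)+
    have f_\<delta>: "puiseux_coeff (f \<delta>) (q + e j) = of_real s / T ^ 2 * puiseux_coeff H q" if j: "j < J" for j
    proof -
      have "q + e j < r + 2 * of_nat p - w" using e(2)[OF j] p(1) by linarith
      then have "puiseux_coeff R (q + e j) = 0" by (rule puiseux_ord_geD[OF ord_R])
      moreover have "puiseux_coeff (P0 * H) (q + e j) = puiseux_coeff H q"
      proof -
        have "puiseux_coeff (P0 * H) (q + e j) = (\<Sum>i<J. puiseux_coeff H (q + e j - e i))"
          by (simp add: P0_def sum_distrib_right coeff_puiseux_simps coeff_puiseux_monom_mult)
        also have "\<dots> = (\<Sum>i\<in>{j}. puiseux_coeff H (q + e j - e i))"
          using j H_e by (intro sum.mono_neutral_right) auto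
        finally show ?thesis by simp
      qed
      ultimately show ?thesis using f_e[OF j] by (simp add: R_def coeff_puiseux_simps)
    qed
    let ?u = "norm (of_real s / T ^ 2 * puiseux_coeff H q)"
    have "?u < 1"
    proof (rule ccontr)
      assume "\<not> ?u < 1"
      then have half: "1 / 2 \<le> ?u / (1 + ?u)" by (simp add: field_simps)
      have inj: "inj_on (\<lambda>j. q + e j) {..<J}" using M by (auto simp: inj_on_def e_def)
      have "1 < real J * (2 powr (- (of_rat q + real p + 1)) * (1 / 2))"
      proof -
        have "2 powr (- (of_rat q + real p + 1)) * (1 / 2) = (1 :: real) / 2 powr (of_rat q + real p + 2)"
          using powr_add[of 2 "of_rat q + real p + 1" 1] powr_minus_divide[of 2 "of_rat q + real p + 1"]
          by (simp only: add.assoc one_add_one) simp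
        then show ?thesis using J by (simp only:) simp
      qed
      also have "\<dots> = (\<Sum>j<J. 2 powr (- (of_rat q + real p + 1)) * (1 / 2))" by simp
      also have "\<dots> \<le> (\<Sum>j<J. 2 powr (- of_rat (q + e j)) * (?u / (1 + ?u)))"
      proof (intro sum_mono mult_mono half)
        fix j assume "j \<in> {..<J}"
        then have "q + e j < q + (of_nat p + 1)" using e by auto
        then have "(of_rat (q + e j) :: real) < of_rat (q + (of_nat p + 1))" by (simp only: of_rat_less)
        then show "2 powr (- (of_rat q + real p + 1)) \<le> (2 :: real) powr (- of_rat (q + e j))"
          by (intro powr_mono) (auto simp: of_rat_add)
      qed auto
      also have "\<dots> = (\<Sum>q\<in>(\<lambda>j. q + e j) ` {..<J}.
          2 powr (- of_rat q) * (norm (puiseux_coeff (f \<delta>) q) / (1 + norm (puiseux_coeff (f \<delta>) q))))"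
        unfolding sum.reindex[OF inj] by (intro sum.cong) (auto simp: f_\<delta>)
      also have "\<dots> \<le> puiseux_size (f \<delta>)" by (rule puiseux_size_sum_le) simp
      also have "\<dots> < 1" unfolding f_def by (rule quot[OF \<delta>(1) \<delta>0 \<delta>(2)])
      finally show False .
    qed
    then have "s * norm (puiseux_coeff H q) < norm T ^ 2"
      using s T by (simp add: norm_mult norm_divide norm_power field_simps)
    then have "norm (puiseux_coeff H q) \<le> 1 / s * norm T ^ 2"
      using s by (simp add: field_simps)
    then show "norm (puiseux_coeff (puiseux_const T * (\<phi>' (\<alpha> + puiseux_const T * \<zeta>) * \<zeta>)
        - \<phi> (\<alpha> + puiseux_const T * \<zeta>) + \<phi> \<alpha>) q) \<le> 1 / s * norm T ^ 2"
      by (simp only: H_def W_def)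
  qed
qed

section \<open>Vanishing of the derivatives of order at least three along lines\<close>

text \<open>Replacing \<eta> by y^m \<eta> turns the k-th derivative at exponent q into the
  coefficient of T^k at exponent q + k m. There T ranges over all complex numbers, so growth at
  infinity can be exploited.\<close>

lemma higher_deriv_along_line_eq_0:
  assumes \<alpha>: "\<alpha> \<in> U" and \<eta>: "\<eta> \<in> puiseux_valring" and k: "k \<ge> 3"
  shows "(deriv ^^ k) (\<lambda>z. puiseux_coeff (\<phi> (\<alpha> + puiseux_const z * \<eta>)) q) 0 = 0"
proof (cases "\<eta> = 0")
  case True
  then show ?thesis using k by simp
next
  case False
  obtain d1 r where d1: "d1 > 0" "\<And>\<delta>. \<delta> \<in> puiseux_valring \<Longrightarrow> puiseux_size \<delta> < d1 \<Longrightarrow> \<alpha> + \<delta> \<in> U"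
    "\<And>\<delta>. \<delta> \<in> puiseux_valring \<Longrightarrow> puiseux_size \<delta> < d1 \<Longrightarrow> puiseux_ord_ge (\<phi> (\<alpha> + \<delta>)) r"
    using local_ball[OF \<alpha>] by blast
  obtain d2 where d2: "d2 > 0" "\<And>\<delta>. \<delta> \<in> puiseux_valring \<Longrightarrow> \<delta> \<noteq> 0 \<Longrightarrow> puiseux_size \<delta> < d2 \<Longrightarrow>
                 puiseux_size ((\<phi> (\<alpha> + \<delta>) - \<phi> \<alpha>) / \<delta> - \<phi>' \<alpha>) < 1"
    using tendstoD[OF has_deriv[OF \<alpha>] zero_less_one] unfolding eventually_at
    by (auto simp: dist_puiseux_def)
  define d where "d = min d1 d2"
  have d: "d > 0" "d \<le> d1" "d \<le> d2" using d1 d2 by (auto simp: d_def)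
  obtain m :: nat where m: "m > 0"
      "\<And>c. puiseux_size (puiseux_const c * (puiseux_monom (of_nat m) * \<eta>)) < d / 2"
    using puiseux_size_monom_const_mult_small[of "d / 2" \<eta>] d by auto
  define \<zeta> where "\<zeta> = puiseux_monom (of_nat m) * \<eta>"
  have \<zeta>: "\<zeta> \<in> puiseux_valring" "\<zeta> \<noteq> 0" "\<And>T. puiseux_size (puiseux_const T * \<zeta>) < d / 2"
    using False \<eta> m puiseux_valring_mult[OF puiseux_valring_monom[of "of_nat m"] \<eta>]
    by (auto simp: \<zeta>_def)
  obtain \<rho> where \<rho>: "\<rho> > 0" "\<And>c. norm c < \<rho> \<Longrightarrow> puiseux_size (puiseux_const c * \<eta>) < d / 2"
    using puiseux_size_const_mult_small[of "d / 2" \<eta>] d by auto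
  have in_ball: "puiseux_const z * \<eta> + puiseux_const t * \<zeta> \<in> puiseux_valring"
      "puiseux_size (puiseux_const z * \<eta> + puiseux_const t * \<zeta>) < d1" if "norm z < \<rho>" for z t
    using \<zeta>(3)[of t] \<rho>(2)[OF that] d(2)
      puiseux_size_triangle[of "puiseux_const z * \<eta>" "puiseux_const t * \<zeta>"]
    by (auto intro!: puiseux_valring_add puiseux_valring_const_mult \<eta> \<zeta>)
  define q' where "q' = q + of_nat k * of_nat m"
  \<comment> \<open>Large enough for the term T^k to occur and for \<open>q'\<close> to lie below r
    + n m, where the expansion is exact.\<close>
  define n where "n = Suc (max k (nat \<lceil>q' - r\<rceil>))"
  have n: "k < n" "q' < r + of_nat n * of_nat m"
  proof -
    have "q' - r < of_nat n" unfolding n_def by linarith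
    also have "(of_nat n :: rat) * 1 \<le> of_nat n * of_nat m" using m(1) by (intro mult_left_mono) auto
    finally show "q' < r + of_nat n * of_nat m" by simp
  qed (simp add: n_def)
  define c where "c = (\<lambda>j. (deriv ^^ j) (\<lambda>z. puiseux_coeff (\<phi> (\<alpha> + puiseux_const z * \<eta>)) (q' - of_nat j * of_nat m)) 0 / fact j)"
  \<comment> \<open>All multiples of \<zeta> are admissible, so the expansion applies on the t-disc
    of radius |T| + 1, for every T.\<close>
  have G: "puiseux_coeff (\<phi> (\<alpha> + puiseux_const T * \<zeta>)) q' = (\<Sum>j<n. c j * T ^ j)" for T
  proof -
    have "puiseux_coeff (\<phi> (\<alpha> + puiseux_const T * \<zeta>)) q' = (\<Sum>j<n. T ^ j / fact j *
        (deriv ^^ j) (\<lambda>z. puiseux_coeff (\<phi> (\<alpha> + puiseux_const z * \<eta>)) (q' - of_nat j * of_nat m)) 0)"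
      using taylor_shift[of \<eta> "of_nat m" \<rho> "norm T + 1" \<alpha> r 0 T q' n] \<eta> n(2) \<rho>(1)
        d1(2)[OF in_ball] d1(3)[OF in_ball]
      by (simp add: \<zeta>_def[symmetric] add.assoc)
    then show ?thesis by (simp add: c_def mult.commute)
  qed
  have inU: "\<alpha> + puiseux_const T * \<zeta> \<in> U" for T
    using in_ball[of 0 T] \<rho>(1) d1(2) by simp
  have G': "puiseux_coeff (\<phi>' (\<alpha> + puiseux_const T * \<zeta>) * \<zeta>) q' = (\<Sum>j<n. c j * (of_nat j * T ^ (j - 1)))" for T
  proof (rule DERIV_unique[OF coeff_deriv[OF inU \<zeta>(1)]])
    show "((\<lambda>T. puiseux_coeff (\<phi> (\<alpha> + puiseux_const T * \<zeta>)) q')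
       has_field_derivative (\<Sum>j<n. c j * (of_nat j * T ^ (j - 1)))) (at T)"
      unfolding G by (intro DERIV_sum DERIV_cmult) (auto intro!: derivative_eq_intros)
  qed
  obtain C where C: "\<And>T. T \<noteq> 0 \<Longrightarrow> norm (puiseux_coeff (puiseux_const T *
      (\<phi>' (\<alpha> + puiseux_const T * \<zeta>) * \<zeta>) - \<phi> (\<alpha> + puiseux_const T * \<zeta>) + \<phi> \<alpha>) q') \<le> C * norm T ^ 2"
    using difference_quotient_growth_bound[of \<alpha> d r \<zeta> q'] \<alpha> \<zeta> d1 d2 d by force
  \<comment> \<open>T d/dT - 1 multiplies the term T^j by j - 1, and adding \<phi>(\<alpha>) removes
    the constant term. For k at least 3 the factor k - 1 is nonzero, so a bound on this polynomial
    controls \<open>c k\<close>.\<close>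
  have h: "puiseux_coeff (puiseux_const T * (\<phi>' (\<alpha> + puiseux_const T * \<zeta>) * \<zeta>)
        - \<phi> (\<alpha> + puiseux_const T * \<zeta>) + \<phi> \<alpha>) q'
      = (\<Sum>j<n. (if j = 0 then 0 else (of_nat j - 1) * c j) * T ^ j)" for T
  proof -
    have "puiseux_coeff (\<phi> \<alpha>) q' = (\<Sum>j<n. c j * 0 ^ j)"
      using G[of 0] by (simp only: puiseux_const_0 mult_zero_left add_0_right)
    also have "\<dots> = (\<Sum>j<n. if j = 0 then c j else 0)"
      by (intro sum.cong) (auto simp: power_0_left)
    finally have c0: "puiseux_coeff (\<phi> \<alpha>) q' = (\<Sum>j<n. if j = 0 then c j else 0)" .
    show ?thesis
      unfolding coeff_puiseux_simps G G' c0 sum_distrib_left sum_subtractf[symmetric] sum.distrib[symmetric]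
    proof (intro sum.cong refl)
      fix j
      show "T * (c j * (of_nat j * T ^ (j - 1))) - c j * T ^ j + (if j = 0 then c j else 0)
          = (if j = 0 then 0 else (of_nat j - 1) * c j) * T ^ j"
        by (cases j) (simp_all add: algebra_simps)
    qed
  qed
  have "(if k = 0 then 0 else (of_nat k - 1) * c k) = 0"
    by (rule polynomial_growth_coeff_zero[OF _ _ n(1), of _ C 2]) (use C k in \<open>auto simp: h\<close>)
  then have "c k = 0" using k by auto
  then show ?thesis by (simp add: c_def q'_def)
qed

text \<open>The coefficient is holomorphic on the disc, so its power series at the centre represents
  it on the entire disc, and that series stops after the quadratic term. The disc need not lie in a
  small ball.\<close>

lemma quadratic_on_disc:
  assumes \<eta>: "\<eta> \<in> puiseux_valring"
    and disc: "\<And>z. norm z < \<rho> \<Longrightarrow> \<alpha> + puiseux_const z * \<eta> \<in> U" and "\<rho> > 0"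
  obtains b c where "\<And>z. norm z < \<rho> \<Longrightarrow>
    puiseux_coeff (\<phi> (\<alpha> + puiseux_const z * \<eta>)) q = puiseux_coeff (\<phi> \<alpha>) q + b * z + c * z ^ 2"
proof -
  define g where "g = (\<lambda>z. puiseux_coeff (\<phi> (\<alpha> + puiseux_const z * \<eta>)) q)"
  have \<alpha>: "\<alpha> \<in> U" using disc[of 0] \<open>\<rho> > 0\<close> by simp
  have hol: "g holomorphic_on ball 0 \<rho>"
    unfolding holomorphic_on_def
  proof
    fix z :: complex assume "z \<in> ball 0 \<rho>"
    then have "\<alpha> + puiseux_const z * \<eta> \<in> U" using disc by simp
    from coeff_deriv[OF this \<eta>, of q] show "g field_differentiable at z within ball 0 \<rho>"
      unfolding g_def field_differentiable_def using has_field_derivative_at_within by blast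
  qed
  show ?thesis
  proof (rule that[of "deriv g 0" "(deriv ^^ 2) g 0 / 2"])
    fix z :: complex assume z: "norm z < \<rho>"
    have "(\<lambda>n. (deriv ^^ n) g 0 / fact n * (z - 0) ^ n) sums g z"
      using z by (intro holomorphic_power_series[OF hol]) simp
    moreover have "(\<lambda>n. (deriv ^^ n) g 0 / fact n * (z - 0) ^ n) sums (\<Sum>n<3. (deriv ^^ n) g 0 / fact n * (z - 0) ^ n)"
      by (rule sums_finite) (auto simp: g_def higher_deriv_along_line_eq_0[OF \<alpha> \<eta>])
    ultimately have "g z = (\<Sum>n<3. (deriv ^^ n) g 0 / fact n * (z - 0) ^ n)"
      by (rule sums_unique2)
    then show "puiseux_coeff (\<phi> (\<alpha> + puiseux_const z * \<eta>)) q
        = puiseux_coeff (\<phi> \<alpha>) q + deriv g 0 * z + (deriv ^^ 2) g 0 / 2 * z ^ 2"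
      by (simp add: eval_nat_numeral) (simp add: g_def)
  qed
qed

section \<open>From quadratic behaviour on lines to a quadratic polynomial on a ball\<close>

text \<open>The trapezoid rule is exact for quadratic functions. It eliminates the coefficients b
  and c, which depend on the line and on q, in favour of values of \<phi> and \<phi>'. Radius 2
  places the endpoint z = 1 inside the disc.\<close>

lemma trapezoid_rule:
  assumes \<eta>: "\<eta> \<in> puiseux_valring"
    and disc: "\<And>z. norm z < 2 \<Longrightarrow> \<alpha> + puiseux_const z * \<eta> \<in> U"
  shows "2 * (\<phi> (\<alpha> + \<eta>) - \<phi> \<alpha>) = (\<phi>' \<alpha> + \<phi>' (\<alpha> + \<eta>)) * \<eta>"
proof (rule puiseux_eqI)
  fix q :: rat
  obtain b c where bc: "\<And>z. norm z < 2 \<Longrightarrow>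
    puiseux_coeff (\<phi> (\<alpha> + puiseux_const z * \<eta>)) q = puiseux_coeff (\<phi> \<alpha>) q + b * z + c * z ^ 2"
    using quadratic_on_disc[OF \<eta> disc, of 2 q] by auto
  have d: "puiseux_coeff (\<phi>' (\<alpha> + puiseux_const z * \<eta>) * \<eta>) q = b + 2 * c * z" if "norm z < 2" for z
  proof (rule DERIV_unique[OF coeff_deriv[OF disc[OF that] \<eta>]])
    have "((\<lambda>z. puiseux_coeff (\<phi> \<alpha>) q + b * z + c * z ^ 2) has_field_derivative b + 2 * c * z) (at z)"
      by (auto intro!: derivative_eq_intros)
    then show "((\<lambda>z. puiseux_coeff (\<phi> (\<alpha> + puiseux_const z * \<eta>)) q)
        has_field_derivative b + 2 * c * z) (at z)"
      by (rule has_field_derivative_transform_within_open[of _ _ _ "ball 0 2"]) (use that bc in auto)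
  qed
  have "puiseux_coeff (2 * x) q = 2 * puiseux_coeff x q" for x
    using coeff_puiseux_const_mult[of 2] by simp
  then show "puiseux_coeff (2 * (\<phi> (\<alpha> + \<eta>) - \<phi> \<alpha>)) q
      = puiseux_coeff ((\<phi>' \<alpha> + \<phi>' (\<alpha> + \<eta>)) * \<eta>) q"
    using bc[of 1] d[of 0] d[of 1] by (simp add: distrib_right coeff_puiseux_simps)
qed

lemma local_quadratic:
  assumes \<alpha>: "\<alpha> \<in> U"
  obtains d c where "d > 0"
    "\<And>\<delta>. \<delta> \<in> puiseux_valring \<Longrightarrow> puiseux_size \<delta> < d \<Longrightarrow> \<alpha> + \<delta> \<in> U"
    "\<And>\<delta>. \<delta> \<in> puiseux_valring \<Longrightarrow> puiseux_size \<delta> < d \<Longrightarrow> \<phi>' (\<alpha> + \<delta>) = \<phi>' \<alpha> + c * \<delta>"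
    "\<And>\<delta>. \<delta> \<in> puiseux_valring \<Longrightarrow> puiseux_size \<delta> < d \<Longrightarrow> \<phi> (\<alpha> + \<delta>) = \<phi> \<alpha> + \<phi>' \<alpha> * \<delta> + c / 2 * \<delta> ^ 2"
proof -
  obtain e r where e: "e > 0" "\<And>\<delta>. \<delta> \<in> puiseux_valring \<Longrightarrow> puiseux_size \<delta> < e \<Longrightarrow> \<alpha> + \<delta> \<in> U"
    "\<And>\<delta>. \<delta> \<in> puiseux_valring \<Longrightarrow> puiseux_size \<delta> < e \<Longrightarrow> puiseux_ord_ge (\<phi> (\<alpha> + \<delta>)) r"
    using local_ball[OF \<alpha>] by blast
  \<comment> \<open>A point \<delta> + z (\<eta> - \<delta>) with |z| < 2 has size below d + 2 (d +
    d) = 5 d, which is less than \<open>e\<close>.\<close>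
  define d where "d = e / 8"
  have d: "d > 0" using e by (simp add: d_def)
  have size2: "puiseux_size (puiseux_const z * x) \<le> 2 * puiseux_size x" if "norm z < 2" for z x
    using puiseux_size_const_mult_mono[of z 2 x] that puiseux_size_double[of x] by simp
  have trap: "2 * (\<phi> (\<alpha> + \<eta>) - \<phi> (\<alpha> + \<delta>)) = (\<phi>' (\<alpha> + \<delta>) + \<phi>' (\<alpha> + \<eta>)) * (\<eta> - \<delta>)"
    if in_ball: "\<delta> \<in> puiseux_valring" "puiseux_size \<delta> < d" "\<eta> \<in> puiseux_valring" "puiseux_size \<eta> < d"
    for \<delta> \<eta>
  proof -
    have "\<alpha> + \<delta> + puiseux_const z * (\<eta> - \<delta>) \<in> U" if z: "norm z < 2" for z
      unfolding add.assoc
    proof (rule e(2))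
      show "puiseux_size (\<delta> + puiseux_const z * (\<eta> - \<delta>)) < e"
        using size2[OF z, of "\<eta> - \<delta>"] puiseux_size_triangle[of \<delta> "puiseux_const z * (\<eta> - \<delta>)"]
          puiseux_size_minus_triangle[of \<eta> \<delta>] in_ball(2,4) d by (simp add: d_def)
    qed (intro puiseux_valring_add puiseux_valring_const_mult puiseux_valring_diff in_ball)
    then show ?thesis
      using trapezoid_rule[of "\<eta> - \<delta>" "\<alpha> + \<delta>"] in_ball by (simp add: puiseux_valring_diff)
  qed
  obtain s where s: "s > 0" "\<And>c. norm c < s \<Longrightarrow> puiseux_size (puiseux_const c * 1) < d"
    using puiseux_size_const_mult_small[OF d] by blast
  \<comment> \<open>A fixed nonzero reference increment. The slope \<open>c\<close> is measured at
    it once and then shown to serve every \<delta>.\<close>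
  define \<eta> where "\<eta> = puiseux_const (of_real (s / 2))"
  have \<eta>: "\<eta> \<in> puiseux_valring" "puiseux_size \<eta> < d" "\<eta> \<noteq> 0"
    using s(1) s(2)[of "of_real (s / 2)"] by (simp_all add: \<eta>_def puiseux_const_in_valring)
  define c where "c = (\<phi>' (\<alpha> + \<eta>) - \<phi>' \<alpha>) / \<eta>"
  have \<phi>': "\<phi>' (\<alpha> + \<delta>) = \<phi>' \<alpha> + c * \<delta>" if "\<delta> \<in> puiseux_valring" "puiseux_size \<delta> < d" for \<delta>
  proof -
    have 0: "0 \<in> puiseux_valring" "puiseux_size 0 < d"
      using d by (simp_all add: puiseux_valring_iff puiseux_ord_ge_def coeff_puiseux_zero)
    have "2 * (\<phi> (\<alpha> + \<delta>) - \<phi> \<alpha>) = (\<phi>' \<alpha> + \<phi>' (\<alpha> + \<delta>)) * \<delta>"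
      "2 * (\<phi> (\<alpha> + \<eta>) - \<phi> \<alpha>) = (\<phi>' \<alpha> + \<phi>' (\<alpha> + \<eta>)) * \<eta>"
      "2 * (\<phi> (\<alpha> + \<eta>) - \<phi> (\<alpha> + \<delta>)) = (\<phi>' (\<alpha> + \<delta>) + \<phi>' (\<alpha> + \<eta>)) * (\<eta> - \<delta>)"
      using trap[OF 0 that] trap[OF 0 \<eta>(1,2)] trap[OF that \<eta>(1,2)] by simp_all
    \<comment> \<open>The increments of \<open>\<phi>\<close> along the sides of the triangle \<open>\<alpha>, \<alpha> + \<delta>, \<alpha> + \<eta>\<close> add up to 0.\<close>
    then have "(\<phi>' (\<alpha> + \<delta>) - \<phi>' \<alpha>) * \<eta> = (\<phi>' (\<alpha> + \<eta>) - \<phi>' \<alpha>) * \<delta>"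
      by algebra
    then show ?thesis using \<eta>(3) by (simp add: c_def field_simps)
  qed
  show ?thesis
  proof (rule that[OF d _ \<phi>'])
    fix \<delta> assume \<delta>: "\<delta> \<in> puiseux_valring" "puiseux_size \<delta> < d"
    then show "\<alpha> + \<delta> \<in> U" using d by (intro e(2)) (auto simp: d_def)
    have "2 * (\<phi> (\<alpha> + \<delta>) - \<phi> \<alpha>) = (\<phi>' \<alpha> + \<phi>' (\<alpha> + \<delta>)) * \<delta>"
      using trap[of 0 \<delta>] \<delta> d by (simp add: puiseux_valring_iff puiseux_ord_ge_def coeff_puiseux_zero)
    then have "2 * \<phi> (\<alpha> + \<delta>) = 2 * (\<phi> \<alpha> + \<phi>' \<alpha> * \<delta> + c / 2 * \<delta> ^ 2)"
      unfolding \<phi>'[OF \<delta>] by (simp add: algebra_simps power2_eq_square)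
    then show "\<phi> (\<alpha> + \<delta>) = \<phi> \<alpha> + \<phi>' \<alpha> * \<delta> + c / 2 * \<delta> ^ 2"
      by (simp only: mult_cancel_left) simp
  qed
qed

end

section \<open>Cauchy formula and Taylor expansion\<close>

lemma puiseux_deriv_eqI: "puiseux_has_derivative f D \<alpha> \<Longrightarrow> puiseux_deriv f \<alpha> = D"
  unfolding puiseux_deriv_def by (intro the_equality) (auto intro: puiseux_has_derivative_unique)

lemma puiseux_has_derivative_affine:
  assumes "d > 0"
    and "\<And>\<delta>. \<delta> \<in> puiseux_valring \<Longrightarrow> puiseux_size \<delta> < d \<Longrightarrow> f (\<alpha> + \<delta>) = f \<alpha> + c * \<delta>"
  shows "puiseux_has_derivative f c \<alpha>"
  unfolding puiseux_has_derivative_def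
  by (rule tendsto_eventually) (use assms in \<open>auto simp: eventually_at dist_puiseux_def\<close>)

lemma contour_integral_power_int:
  assumes "contour_around_0 C"
  shows "((\<lambda>z. z powi n) has_contour_integral (if n = -1 then 2 * pi * \<i> else 0)) C"
proof (cases "n = -1")
  case True
  then show ?thesis
    using assms has_contour_integral_winding_number[of C 0]
    by (simp add: contour_around_0_def power_int_minus inverse_eq_divide)
next
  case False
  have "((\<lambda>z. z powi n) has_contour_integral 0) C"
  proof (rule Cauchy_theorem_primitive[of "- {0}"])
    fix z :: complex assume "z \<in> - {0}"
    moreover have "of_int n + 1 \<noteq> (0 :: complex)"
      using False by (metis of_int_1 of_int_add of_int_eq_0_iff eq_neg_iff_add_eq_0)
    ultimately show "((\<lambda>z. z powi (n + 1) / of_int (n + 1)) has_field_derivative z powi n) (at z within - {0})"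
      by (auto intro!: derivative_eq_intros)
  qed (use assms in \<open>auto simp: contour_around_0_def\<close>)
  with False show ?thesis by simp
qed

text \<open>A residue computation for finitely many powers of z with series as coefficients. The
  formula for F is required on the path only, so values at z = 0, where division returns a default,
  do not matter.\<close>

lemma has_puiseux_contour_integral_laurent_polynomial:
  assumes "contour_around_0 C" and "finite A"
    and F: "\<And>z. z \<in> path_image C \<Longrightarrow> F z = (\<Sum>j\<in>A. puiseux_const (z powi n j) * b j)"
  shows "has_puiseux_contour_integral F
           (\<Sum>j\<in>A. if n j = -1 then puiseux_const (2 * pi * \<i>) * b j else 0) C"
  unfolding has_puiseux_contour_integral_def
proof
  fix q
  have "((\<lambda>z. \<Sum>j\<in>A. z powi n j * puiseux_coeff (b j) q) has_contour_integral
      (\<Sum>j\<in>A. (if n j = -1 then 2 * pi * \<i> else 0) * puiseux_coeff (b j) q)) C"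
    using assms by (intro has_contour_integral_sum has_contour_integral_rmul contour_integral_power_int)
  also have "(\<Sum>j\<in>A. (if n j = -1 then 2 * pi * \<i> else 0) * puiseux_coeff (b j) q)
      = puiseux_coeff (\<Sum>j\<in>A. if n j = -1 then puiseux_const (2 * pi * \<i>) * b j else 0) q"
    unfolding coeff_puiseux_sum
    by (intro sum.cong) (auto simp: coeff_puiseux_simps)
  finally show "((\<lambda>z. puiseux_coeff (F z) q) has_contour_integral
      puiseux_coeff (\<Sum>j\<in>A. if n j = -1 then puiseux_const (2 * pi * \<i>) * b j else 0) q) C"
    by (rule has_contour_integral_eq) (simp add: F coeff_puiseux_simps)
qed

context puiseux_differentiable
begin

abbreviation \<phi>'' :: "puiseux \<Rightarrow> puiseux" where "\<phi>'' \<equiv> puiseux_deriv \<phi>'"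

text \<open>Identifies the slope \<open>c\<close> of the affine function \<phi>' with the second
  derivative at every point of the ball; hence \<phi>'' is locally constant.\<close>

lemma local_expansion:
  assumes \<alpha>: "\<alpha> \<in> U"
  obtains d where "d > 0"
    "\<And>\<delta>. \<delta> \<in> puiseux_valring \<Longrightarrow> puiseux_size \<delta> < d \<Longrightarrow> \<alpha> + \<delta> \<in> U"
    "\<And>\<delta>. \<delta> \<in> puiseux_valring \<Longrightarrow> puiseux_size \<delta> < d \<Longrightarrow> \<phi>'' (\<alpha> + \<delta>) = \<phi>'' \<alpha>"
    "\<And>\<delta>. \<delta> \<in> puiseux_valring \<Longrightarrow> puiseux_size \<delta> < d \<Longrightarrow> \<phi>' (\<alpha> + \<delta>) = \<phi>' \<alpha> + \<phi>'' \<alpha> * \<delta>"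
    "\<And>\<delta>. \<delta> \<in> puiseux_valring \<Longrightarrow> puiseux_size \<delta> < d \<Longrightarrow>
       \<phi> (\<alpha> + \<delta>) = \<phi> \<alpha> + \<phi>' \<alpha> * \<delta> + \<phi>'' \<alpha> / 2 * \<delta> ^ 2"
proof -
  obtain d c where d: "d > 0"
    "\<And>\<delta>. \<delta> \<in> puiseux_valring \<Longrightarrow> puiseux_size \<delta> < d \<Longrightarrow> \<alpha> + \<delta> \<in> U"
    "\<And>\<delta>. \<delta> \<in> puiseux_valring \<Longrightarrow> puiseux_size \<delta> < d \<Longrightarrow> \<phi>' (\<alpha> + \<delta>) = \<phi>' \<alpha> + c * \<delta>"
    "\<And>\<delta>. \<delta> \<in> puiseux_valring \<Longrightarrow> puiseux_size \<delta> < d \<Longrightarrow> \<phi> (\<alpha> + \<delta>) = \<phi> \<alpha> + \<phi>' \<alpha> * \<delta> + c / 2 * \<delta> ^ 2"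
    using local_quadratic[OF \<alpha>] by blast
  have c: "\<phi>'' (\<alpha> + \<delta>) = c" if \<delta>: "\<delta> \<in> puiseux_valring" "puiseux_size \<delta> < d" for \<delta>
  \<comment> \<open>Around \<alpha> + \<delta> the affine formula centred at \<alpha> is still valid
    on the remaining radius.\<close>
  proof (rule puiseux_deriv_eqI, rule puiseux_has_derivative_affine[of "d - puiseux_size \<delta>"])
    show "d - puiseux_size \<delta> > 0" using \<delta> by simp
    fix \<eta> assume \<eta>: "\<eta> \<in> puiseux_valring" "puiseux_size \<eta> < d - puiseux_size \<delta>"
    then have "\<phi>' (\<alpha> + (\<delta> + \<eta>)) = \<phi>' \<alpha> + c * (\<delta> + \<eta>)"
      using puiseux_size_triangle[of \<delta> \<eta>] \<delta> by (intro d(3) puiseux_valring_add) auto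
    then show "\<phi>' (\<alpha> + \<delta> + \<eta>) = \<phi>' (\<alpha> + \<delta>) + c * \<eta>"
      by (simp add: d(3)[OF \<delta>] algebra_simps)
  qed
  have c0: "\<phi>'' \<alpha> = c"
    using c[of 0] d(1) by (simp add: puiseux_valring_iff puiseux_ord_ge_def coeff_puiseux_zero)
  show ?thesis
    by (rule that[OF d(1,2)]) (auto simp: c0 c d(3,4))
qed

text \<open>Local constancy of \<phi>'' gives third derivative 0. From then on each derivative is 0
  throughout U, and openness of U suffices for the induction.\<close>

lemma has_derivative_higher:
  assumes "\<alpha> \<in> U"
  shows "puiseux_has_derivative \<phi> (\<phi>' \<alpha>) \<alpha>"
    and "puiseux_has_derivative \<phi>' (\<phi>'' \<alpha>) \<alpha>"
    and "puiseux_has_derivative ((puiseux_deriv ^^ (k + 2)) \<phi>) 0 \<alpha>"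
proof -
  show "puiseux_has_derivative \<phi> (\<phi>' \<alpha>) \<alpha>"
    using has_deriv[OF assms] by (simp add: puiseux_has_derivative_def)
  have second: "puiseux_has_derivative \<phi>' (\<phi>'' \<alpha>) \<alpha> \<and> puiseux_has_derivative \<phi>'' 0 \<alpha>"
    if \<alpha>: "\<alpha> \<in> U" for \<alpha>
  proof -
    obtain d where d: "d > 0"
      "\<And>\<delta>. \<delta> \<in> puiseux_valring \<Longrightarrow> puiseux_size \<delta> < d \<Longrightarrow> \<alpha> + \<delta> \<in> U"
      "\<And>\<delta>. \<delta> \<in> puiseux_valring \<Longrightarrow> puiseux_size \<delta> < d \<Longrightarrow> \<phi>'' (\<alpha> + \<delta>) = \<phi>'' \<alpha>"
      "\<And>\<delta>. \<delta> \<in> puiseux_valring \<Longrightarrow> puiseux_size \<delta> < d \<Longrightarrow> \<phi>' (\<alpha> + \<delta>) = \<phi>' \<alpha> + \<phi>'' \<alpha> * \<delta>"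
      "\<And>\<delta>. \<delta> \<in> puiseux_valring \<Longrightarrow> puiseux_size \<delta> < d \<Longrightarrow>
         \<phi> (\<alpha> + \<delta>) = \<phi> \<alpha> + \<phi>' \<alpha> * \<delta> + \<phi>'' \<alpha> / 2 * \<delta> ^ 2"
      using local_expansion[OF \<alpha>] by blast
    show ?thesis
      using puiseux_has_derivative_affine[of d \<phi>'] puiseux_has_derivative_affine[of d \<phi>'' \<alpha> 0] d by auto
  qed
  then show "puiseux_has_derivative \<phi>' (\<phi>'' \<alpha>) \<alpha>" using assms by blast
  show "puiseux_has_derivative ((puiseux_deriv ^^ (k + 2)) \<phi>) 0 \<alpha>"
    using assms
  proof (induction k arbitrary: \<alpha>)
    case 0
    then show ?case using second by (simp add: numeral_2_eq_2)
  next
    case (Suc k)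
    obtain d r where d: "d > 0" "\<And>\<delta>. \<delta> \<in> puiseux_valring \<Longrightarrow> puiseux_size \<delta> < d \<Longrightarrow> \<alpha> + \<delta> \<in> U"
      "\<And>\<delta>. \<delta> \<in> puiseux_valring \<Longrightarrow> puiseux_size \<delta> < d \<Longrightarrow> puiseux_ord_ge (\<phi> (\<alpha> + \<delta>)) r"
      using local_ball[OF Suc.prems] by blast
    have "(puiseux_deriv ^^ (Suc k + 2)) \<phi> \<beta> = 0" if "\<beta> \<in> U" for \<beta>
      using puiseux_deriv_eqI[OF Suc.IH[OF that]] by simp
    with d Suc.prems show ?case by (intro puiseux_has_derivative_affine[of d]) auto
  qed
qed

lemma higher_deriv_eq_0:
  assumes "\<alpha> \<in> U" "k \<ge> 3"
  shows "(puiseux_deriv ^^ k) \<phi> \<alpha> = 0"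
proof -
  have "k = Suc (k - 3 + 2)" using assms by simp
  then have "(puiseux_deriv ^^ k) \<phi> \<alpha> = puiseux_deriv ((puiseux_deriv ^^ (k - 3 + 2)) \<phi>) \<alpha>"
    by (metis comp_apply funpow.simps(2))
  also have "\<dots> = 0" by (rule puiseux_deriv_eqI[OF has_derivative_higher(3)[OF assms(1)]])
  finally show ?thesis .
qed

lemma higher_derivatives_exist:
  assumes "\<alpha> \<in> U"
  shows "\<exists>D. puiseux_has_derivative ((puiseux_deriv ^^ k) \<phi>) D \<alpha>"
proof -
  consider "k = 0" | "k = 1" | "k = k - 2 + 2" by linarith
  then show ?thesis
  proof cases
    case 3
    then show ?thesis using has_derivative_higher(3)[OF assms, of "k - 2"] by metis
  qed (use has_derivative_higher[OF assms] in auto)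
qed

section \<open>Cauchy integral formulas, Taylor expansion and multiplicities\<close>

text \<open>On a small z-disc \<phi> is a polynomial of degree at most 2 in z, so every integrand is
  a Laurent polynomial and one \<epsilon> serves all k.\<close>

lemma cauchy_formula_small_contours:
  assumes \<alpha>: "\<alpha> \<in> U" and \<delta>: "\<delta> \<in> puiseux_valring" "\<delta> \<noteq> 0"
  obtains \<epsilon> where "\<epsilon> > 0" "\<And>z. z \<in> ball 0 \<epsilon> \<Longrightarrow> \<alpha> + puiseux_const z * \<delta> \<in> U"
    "\<And>C. contour_around_0 C \<Longrightarrow> path_image C \<subseteq> ball 0 \<epsilon> \<Longrightarrow> has_puiseux_line_integral \<phi> 0 \<alpha> \<delta> C"
    "\<And>C k. contour_around_0 C \<Longrightarrow> path_image C \<subseteq> ball 0 \<epsilon> \<Longrightarrow>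
       \<exists>I. has_puiseux_line_integral (\<lambda>\<mu>. \<phi> \<mu> / (\<mu> - \<alpha>) ^ (k + 1)) I \<alpha> \<delta> C \<and>
         (puiseux_deriv ^^ k) \<phi> \<alpha> = puiseux_const (fact k / (2 * pi * \<i>)) * I"
proof -
  obtain d where d: "d > 0"
    "\<And>\<delta>. \<delta> \<in> puiseux_valring \<Longrightarrow> puiseux_size \<delta> < d \<Longrightarrow> \<alpha> + \<delta> \<in> U"
    "\<And>\<delta>. \<delta> \<in> puiseux_valring \<Longrightarrow> puiseux_size \<delta> < d \<Longrightarrow> \<phi>'' (\<alpha> + \<delta>) = \<phi>'' \<alpha>"
    "\<And>\<delta>. \<delta> \<in> puiseux_valring \<Longrightarrow> puiseux_size \<delta> < d \<Longrightarrow> \<phi>' (\<alpha> + \<delta>) = \<phi>' \<alpha> + \<phi>'' \<alpha> * \<delta>"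
    "\<And>\<delta>. \<delta> \<in> puiseux_valring \<Longrightarrow> puiseux_size \<delta> < d \<Longrightarrow>
       \<phi> (\<alpha> + \<delta>) = \<phi> \<alpha> + \<phi>' \<alpha> * \<delta> + \<phi>'' \<alpha> / 2 * \<delta> ^ 2"
    using local_expansion[OF \<alpha>] by blast
  obtain \<epsilon> where \<epsilon>: "\<epsilon> > 0" "\<And>z. norm z < \<epsilon> \<Longrightarrow> puiseux_size (puiseux_const z * \<delta>) < d"
    using puiseux_size_const_mult_small[OF d(1)] by blast
  define a where "a = (\<lambda>j. (puiseux_deriv ^^ j) \<phi> \<alpha> / fact j)"
  have expand: "\<phi> (\<alpha> + puiseux_const z * \<delta>) = (\<Sum>j<3. a j * (puiseux_const z * \<delta>) ^ j)"
    if "norm z < \<epsilon>" for z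
    using d(5)[OF puiseux_valring_const_mult[OF \<delta>(1)] \<epsilon>(2)[OF that]]
    by (simp add: a_def eval_nat_numeral)
  show ?thesis
  proof (rule that[OF \<epsilon>(1)])
    fix z :: complex assume "z \<in> ball 0 \<epsilon>"
    then show "\<alpha> + puiseux_const z * \<delta> \<in> U"
      using \<epsilon>(2) \<delta> by (intro d(2) puiseux_valring_const_mult) auto
  next
    fix C assume C: "contour_around_0 C" "path_image C \<subseteq> ball 0 \<epsilon>"
    have "has_puiseux_contour_integral (\<lambda>z. \<phi> (\<alpha> + puiseux_const z * \<delta>) * \<delta>)
        (\<Sum>j<3. if int j = -1 then puiseux_const (2 * pi * \<i>) * (a j * \<delta> ^ j * \<delta>) else 0) C"
    proof (rule has_puiseux_contour_integral_laurent_polynomial[OF C(1)])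
      fix z assume "z \<in> path_image C"
      then have "norm z < \<epsilon>" using C(2) by auto
      from expand[OF this] show "\<phi> (\<alpha> + puiseux_const z * \<delta>) * \<delta>
          = (\<Sum>j<3. puiseux_const (z powi int j) * (a j * \<delta> ^ j * \<delta>))"
        by (simp add: sum_distrib_left power_mult_distrib puiseux_const_power mult_ac)
    qed simp
    also have "(\<Sum>j<3. if int j = -1 then puiseux_const (2 * pi * \<i>) * (a j * \<delta> ^ j * \<delta>) else 0) = 0"
      by (intro sum.neutral) auto
    finally show "has_puiseux_line_integral \<phi> 0 \<alpha> \<delta> C"
      by (simp add: has_puiseux_line_integral_def)
    fix k
    \<comment> \<open>The coefficient of z^(j - k - 1): of the k + 1 factors \<delta> in the
      denominator, one is cancelled by d\<mu> = \<delta> dz.\<close>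
    define b where "b = (\<lambda>j. a j * \<delta> ^ j / \<delta> ^ k)"
    define I where "I = (\<Sum>j<3. if int j - int (k + 1) = -1 then puiseux_const (2 * pi * \<i>) * b j else 0)"
    have "has_puiseux_contour_integral (\<lambda>z. \<phi> (\<alpha> + puiseux_const z * \<delta>) / (\<alpha> + puiseux_const z * \<delta> - \<alpha>) ^ (k + 1) * \<delta>) I C"
      unfolding I_def
    proof (rule has_puiseux_contour_integral_laurent_polynomial[OF C(1)])
      fix z assume z: "z \<in> path_image C"
      then have z': "norm z < \<epsilon>" "z \<noteq> 0" using C by (auto simp: contour_around_0_def)
      have "a j * (puiseux_const z * \<delta>) ^ j / (puiseux_const z * \<delta>) ^ (k + 1) * \<delta>
          = puiseux_const (z powi (int j - int (k + 1))) * b j" for j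
      proof -
        have "puiseux_const (z powi (int j - int (k + 1))) = puiseux_const z ^ j / puiseux_const z ^ (k + 1)"
          using z' by (simp only: power_int_diff power_int_of_nat puiseux_const_divide puiseux_const_power simp_thms)
        then show ?thesis using \<delta>(2) z' by (simp add: b_def power_mult_distrib mult_ac)
      qed
      then show "\<phi> (\<alpha> + puiseux_const z * \<delta>) / (\<alpha> + puiseux_const z * \<delta> - \<alpha>) ^ (k + 1) * \<delta>
          = (\<Sum>j<3. puiseux_const (z powi (int j - int (k + 1))) * b j)"
        unfolding expand[OF z'(1)] by (simp only: add_diff_cancel_left' sum_divide_distrib sum_distrib_right)
    qed simp
    moreover have "(puiseux_deriv ^^ k) \<phi> \<alpha> = puiseux_const (fact k / (2 * pi * \<i>)) * I"
    proof (cases "k < 3")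
      case True
      have "I = (\<Sum>j<3. if j = k then puiseux_const (2 * pi * \<i>) * b j else 0)"
        unfolding I_def by (intro sum.cong) auto
      also have "\<dots> = puiseux_const (2 * pi * \<i>) * a k" using True \<delta>(2) by (simp add: b_def)
      finally have "puiseux_const (fact k / (2 * pi * \<i>)) * I
          = puiseux_const (fact k / (2 * pi * \<i>) * (2 * pi * \<i>)) * a k"
        by (simp only: puiseux_const_mult mult.assoc)
      also have "\<dots> = puiseux_const (of_nat (fact k)) * a k" by simp
      also have "\<dots> = (puiseux_deriv ^^ k) \<phi> \<alpha>"
        unfolding puiseux_const_of_nat by (simp add: a_def)
      finally show ?thesis ..
    next
      case False
      \<comment> \<open>The exponent -1 would require j = k, but j stays below 3.\<close>
      then have "I = 0" unfolding I_def by (intro sum.neutral) auto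
      with False show ?thesis using higher_deriv_eq_0[OF \<alpha>, of k] by simp
    qed
    ultimately show "\<exists>I. has_puiseux_line_integral (\<lambda>\<mu>. \<phi> \<mu> / (\<mu> - \<alpha>) ^ (k + 1)) I \<alpha> \<delta> C \<and>
         (puiseux_deriv ^^ k) \<phi> \<alpha> = puiseux_const (fact k / (2 * pi * \<i>)) * I"
      unfolding has_puiseux_line_integral_def by blast
  qed
qed

text \<open>The given disc may extend beyond the ball of the local expansion. Local constancy of
  \<phi>'' spreads over it by connectedness, and integrating twice in z determines \<phi>' and then
  \<phi> on the whole disc.\<close>

lemma taylor_expansion_disc:
  assumes disc: "\<And>z. norm z < r \<Longrightarrow> \<alpha> + puiseux_const z * \<delta> \<in> U" and z: "norm z < r"
  shows "(\<lambda>k. 1 / fact k * (puiseux_deriv ^^ k) \<phi> \<alpha> * (puiseux_const z * \<delta>) ^ k)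
           sums \<phi> (\<alpha> + puiseux_const z * \<delta>)"
proof -
  have r: "r > 0" using z norm_ge_zero order_le_less_trans by blast
  have \<alpha>: "\<alpha> \<in> U" using disc[of 0] r by simp
  \<comment> \<open>Recovered from two points of the disc: (r / 2) \<delta> is a difference of
    elements of U, and scalars are units of the valuation ring.\<close>
  have \<delta>: "\<delta> \<in> puiseux_valring"
  proof -
    have "\<alpha> + puiseux_const (of_real (r / 2)) * \<delta> - \<alpha> \<in> puiseux_valring"
      using r by (intro puiseux_valring_diff U_valring \<alpha> disc) auto
    then have "puiseux_const (of_real (r / 2)) * \<delta> \<in> puiseux_valring" by simp
    then have "puiseux_const (of_real (2 / r)) * (puiseux_const (of_real (r / 2)) * \<delta>) \<in> puiseux_valring"
      by (rule puiseux_valring_const_mult)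
    moreover have "(of_real (2 / r) * of_real (r / 2) :: complex) = 1" using r by simp
    ultimately show ?thesis by (simp only: puiseux_const_mult[symmetric] mult.assoc[symmetric] puiseux_const_1 mult_1_left)
  qed
  define \<mu> where "\<mu> = (\<lambda>z. \<alpha> + puiseux_const z * \<delta>)"
  have \<mu>0: "\<mu> 0 = \<alpha>" by (simp add: \<mu>_def)
  have ball: "z \<in> ball 0 r" using z by simp
  have const: "f z = f 0" if "\<And>z. z \<in> ball 0 r \<Longrightarrow> (f has_field_derivative 0) (at z)"
      and "z \<in> ball 0 r" for f :: "complex \<Rightarrow> complex" and z
  proof -
    have "\<exists>c. \<forall>z\<in>ball 0 r. f z = c"
      by (rule has_field_derivative_zero_constant)
         (use that in \<open>auto intro: has_field_derivative_at_within\<close>)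
    then show ?thesis using that r by force
  qed
  have deriv: "((\<lambda>z. puiseux_coeff (\<phi>'' (\<mu> z)) q) has_field_derivative 0) (at z)"
      "((\<lambda>z. puiseux_coeff (\<phi>' (\<mu> z)) q) has_field_derivative puiseux_coeff (\<phi>'' (\<mu> z) * \<delta>) q) (at z)"
    if "z \<in> ball 0 r" for z q
  proof -
    have "\<mu> z \<in> U" using that disc by (simp add: \<mu>_def)
    then obtain d where d: "d > 0"
      "\<And>\<delta>. \<delta> \<in> puiseux_valring \<Longrightarrow> puiseux_size \<delta> < d \<Longrightarrow> \<mu> z + \<delta> \<in> U"
      "\<And>\<delta>. \<delta> \<in> puiseux_valring \<Longrightarrow> puiseux_size \<delta> < d \<Longrightarrow> \<phi>'' (\<mu> z + \<delta>) = \<phi>'' (\<mu> z)"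
      "\<And>\<delta>. \<delta> \<in> puiseux_valring \<Longrightarrow> puiseux_size \<delta> < d \<Longrightarrow> \<phi>' (\<mu> z + \<delta>) = \<phi>' (\<mu> z) + \<phi>'' (\<mu> z) * \<delta>"
      "\<And>\<delta>. \<delta> \<in> puiseux_valring \<Longrightarrow> puiseux_size \<delta> < d \<Longrightarrow>
         \<phi> (\<mu> z + \<delta>) = \<phi> (\<mu> z) + \<phi>' (\<mu> z) * \<delta> + \<phi>'' (\<mu> z) / 2 * \<delta> ^ 2"
      using local_expansion by blast
    obtain s where s: "s > 0" "\<And>c. norm c < s \<Longrightarrow> puiseux_size (puiseux_const c * \<delta>) < d"
      using puiseux_size_const_mult_small[OF d(1)] by blast
    have shift: "\<mu> y = \<mu> z + puiseux_const (y - z) * \<delta>" for y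
      by (simp add: \<mu>_def puiseux_const_diff algebra_simps)
    have *: "\<phi>'' (\<mu> y) = \<phi>'' (\<mu> z)" "\<phi>' (\<mu> y) = \<phi>' (\<mu> z) + \<phi>'' (\<mu> z) * (puiseux_const (y - z) * \<delta>)"
      if "y \<in> ball z s" for y
      unfolding shift[of y] using that
      by (intro d(3,4) puiseux_valring_const_mult \<delta> s; simp add: dist_norm norm_minus_commute)+
    show "((\<lambda>z. puiseux_coeff (\<phi>'' (\<mu> z)) q) has_field_derivative 0) (at z)"
    proof (rule has_field_derivative_transform_within_open)
      show "((\<lambda>_. puiseux_coeff (\<phi>'' (\<mu> z)) q) has_field_derivative 0) (at z)" by simp
      show "puiseux_coeff (\<phi>'' (\<mu> z)) q = puiseux_coeff (\<phi>'' (\<mu> y)) q" if "y \<in> ball z s" for y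
        using *(1)[OF that] by simp
    qed (use s in auto)
    show "((\<lambda>z. puiseux_coeff (\<phi>' (\<mu> z)) q) has_field_derivative puiseux_coeff (\<phi>'' (\<mu> z) * \<delta>) q) (at z)"
    proof (rule has_field_derivative_transform_within_open)
      show "((\<lambda>y. puiseux_coeff (\<phi>' (\<mu> z)) q + (y - z) * puiseux_coeff (\<phi>'' (\<mu> z) * \<delta>) q)
          has_field_derivative puiseux_coeff (\<phi>'' (\<mu> z) * \<delta>) q) (at z)"
        by (auto intro!: derivative_eq_intros)
      show "puiseux_coeff (\<phi>' (\<mu> z)) q + (y - z) * puiseux_coeff (\<phi>'' (\<mu> z) * \<delta>) q
          = puiseux_coeff (\<phi>' (\<mu> y)) q" if "y \<in> ball z s" for y
        unfolding *(2)[OF that] mult.left_commute[of _ "puiseux_const _"] by (simp add: coeff_puiseux_simps)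
    qed (use s in auto)
  qed
  have second: "\<phi>'' (\<mu> z) = \<phi>'' \<alpha>" if "z \<in> ball 0 r" for z
    using const[OF deriv(1) that] by (intro puiseux_eqI) (simp add: \<mu>0)
  have first: "\<phi>' (\<mu> z) = \<phi>' \<alpha> + \<phi>'' \<alpha> * (puiseux_const z * \<delta>)" if "z \<in> ball 0 r" for z
  proof (rule puiseux_eqI)
    fix q
    have "((\<lambda>z. puiseux_coeff (\<phi>' (\<mu> z)) q - z * puiseux_coeff (\<phi>'' \<alpha> * \<delta>) q) has_field_derivative 0) (at z)"
      if "z \<in> ball 0 r" for z
      using DERIV_diff[OF deriv(2)[OF that, of q] DERIV_cmult_right[OF DERIV_ident, of "puiseux_coeff (\<phi>'' \<alpha> * \<delta>) q"]]
      by (simp add: second[OF that])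
    from const[OF this \<open>z \<in> ball 0 r\<close>]
    show "puiseux_coeff (\<phi>' (\<mu> z)) q = puiseux_coeff (\<phi>' \<alpha> + \<phi>'' \<alpha> * (puiseux_const z * \<delta>)) q"
      unfolding mult.left_commute[of _ "puiseux_const _"] coeff_puiseux_simps \<mu>0
      by (simp add: diff_eq_eq add.assoc)
  qed
  have "\<phi> (\<mu> z) = \<phi> \<alpha> + \<phi>' \<alpha> * (puiseux_const z * \<delta>) + puiseux_const (z ^ 2 / 2) * (\<phi>'' \<alpha> * \<delta> * \<delta>)"
  proof (rule puiseux_eqI)
    fix q
    have "((\<lambda>z. puiseux_coeff (\<phi> (\<mu> z)) q - z * puiseux_coeff (\<phi>' \<alpha> * \<delta>) q
        - z ^ 2 / 2 * puiseux_coeff (\<phi>'' \<alpha> * \<delta> * \<delta>) q) has_field_derivative 0) (at z)"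
      if "z \<in> ball 0 r" for z
    proof -
      have "((\<lambda>z. puiseux_coeff (\<phi> (\<mu> z)) q) has_field_derivative puiseux_coeff (\<phi>' (\<mu> z) * \<delta>) q) (at z)"
        unfolding \<mu>_def using that by (intro coeff_deriv disc \<delta>) simp
      also have "\<phi>' (\<mu> z) * \<delta> = \<phi>' \<alpha> * \<delta> + puiseux_const z * (\<phi>'' \<alpha> * \<delta> * \<delta>)"
        by (simp add: first[OF that] algebra_simps)
      finally show ?thesis by (auto intro!: derivative_eq_intros simp: coeff_puiseux_simps)
    qed
    from const[OF this ball]
    show "puiseux_coeff (\<phi> (\<mu> z)) q = puiseux_coeff (\<phi> \<alpha> + \<phi>' \<alpha> * (puiseux_const z * \<delta>)
        + puiseux_const (z ^ 2 / 2) * (\<phi>'' \<alpha> * \<delta> * \<delta>)) q"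
      unfolding mult.left_commute[of _ "puiseux_const _"] coeff_puiseux_simps \<mu>0
      by (simp add: diff_eq_eq add.assoc)
  qed
  also have "\<dots> = (\<Sum>k<3. 1 / fact k * (puiseux_deriv ^^ k) \<phi> \<alpha> * (puiseux_const z * \<delta>) ^ k)"
    by (simp add: eval_nat_numeral puiseux_const_divide puiseux_const_mult mult_ac)
  finally show ?thesis
    unfolding \<mu>_def using higher_deriv_eq_0[OF \<alpha>] by (simp only:) (rule sums_finite; simp)
qed

text \<open>From the third on all derivatives are 0, so only the multiplicities for k = 0, ..., 3
  occur.\<close>

lemma higher_deriv_mult_bounded:
  assumes "\<alpha> \<in> U"
  shows "\<exists>K. \<forall>k. puiseux_mult ((puiseux_deriv ^^ k) \<phi> \<alpha>) \<le> K"
proof -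
  let ?m = "\<lambda>k. puiseux_mult ((puiseux_deriv ^^ k) \<phi> \<alpha>)"
  have "?m k \<le> Max (?m ` {..3})" for k
  proof -
    have "?m k = ?m (min k 3)" using higher_deriv_eq_0[OF assms] by (simp add: min_def)
    also have "\<dots> \<le> Max (?m ` {..3})" by (intro Max_ge) auto
    finally show ?thesis .
  qed
  then show ?thesis by blast
qed

end

theorem mainTheorem1:
  fixes U :: "puiseux set" and \<phi> :: "puiseux \<Rightarrow> puiseux"
  assumes "openin (top_of_set puiseux_valring) U"
    and "puiseux_lojasiewicz_bounded U \<phi>"
    and "\<forall>\<alpha>\<in>U. \<exists>D. puiseux_has_derivative \<phi> D \<alpha>"
  shows
    "(\<forall>k. \<forall>\<alpha>\<in>U. \<exists>D. puiseux_has_derivative ((puiseux_deriv ^^ k) \<phi>) D \<alpha>) \<and>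
     (\<forall>\<alpha>\<in>U. \<forall>\<delta>\<in>puiseux_valring. \<delta> \<noteq> 0 \<longrightarrow>
        (\<exists>\<epsilon>>0. (\<forall>z\<in>ball 0 \<epsilon>. \<alpha> + puiseux_const z * \<delta> \<in> U) \<and>
          (\<forall>C. contour_around_0 C \<and> path_image C \<subseteq> ball 0 \<epsilon> \<longrightarrow>
             has_puiseux_line_integral \<phi> 0 \<alpha> \<delta> C \<and>
             (\<forall>k. \<exists>I. has_puiseux_line_integral (\<lambda>\<mu>. \<phi> \<mu> / (\<mu> - \<alpha>) ^ (k + 1)) I \<alpha> \<delta> C \<and>
                (puiseux_deriv ^^ k) \<phi> \<alpha> = puiseux_const (fact k / (2 * pi * \<i>)) * I)))) \<and>
     (\<forall>\<alpha> \<delta> r. (\<forall>z. norm z < r \<longrightarrow> \<alpha> + puiseux_const z * \<delta> \<in> U) \<longrightarrow>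
        (\<forall>z. norm z < r \<longrightarrow>
           (\<lambda>k. 1 / fact k * (puiseux_deriv ^^ k) \<phi> \<alpha> * (puiseux_const z * \<delta>) ^ k)
             sums \<phi> (\<alpha> + puiseux_const z * \<delta>))) \<and>
     (\<forall>\<alpha>\<in>U. \<exists>K. \<forall>k. puiseux_mult ((puiseux_deriv ^^ k) \<phi> \<alpha>) \<le> K)"
proof -
  interpret puiseux_differentiable U \<phi>
    using assms by unfold_locales auto
  show ?thesis
  proof (intro conjI allI ballI impI)
    fix \<alpha> \<delta> assume "\<alpha> \<in> U" "\<delta> \<in> puiseux_valring" "\<delta> \<noteq> 0"
    then obtain \<epsilon> where \<epsilon>: "\<epsilon> > 0" "\<And>z. z \<in> ball 0 \<epsilon> \<Longrightarrow> \<alpha> + puiseux_const z * \<delta> \<in> U"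
      "\<And>C. contour_around_0 C \<Longrightarrow> path_image C \<subseteq> ball 0 \<epsilon> \<Longrightarrow> has_puiseux_line_integral \<phi> 0 \<alpha> \<delta> C"
      "\<And>C k. contour_around_0 C \<Longrightarrow> path_image C \<subseteq> ball 0 \<epsilon> \<Longrightarrow>
         \<exists>I. has_puiseux_line_integral (\<lambda>\<mu>. \<phi> \<mu> / (\<mu> - \<alpha>) ^ (k + 1)) I \<alpha> \<delta> C \<and>
           (puiseux_deriv ^^ k) \<phi> \<alpha> = puiseux_const (fact k / (2 * pi * \<i>)) * I"
      by (rule cauchy_formula_small_contours) blast
    show "\<exists>\<epsilon>>0. (\<forall>z\<in>ball 0 \<epsilon>. \<alpha> + puiseux_const z * \<delta> \<in> U) \<and>
          (\<forall>C. contour_around_0 C \<and> path_image C \<subseteq> ball 0 \<epsilon> \<longrightarrow>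
             has_puiseux_line_integral \<phi> 0 \<alpha> \<delta> C \<and>
             (\<forall>k. \<exists>I. has_puiseux_line_integral (\<lambda>\<mu>. \<phi> \<mu> / (\<mu> - \<alpha>) ^ (k + 1)) I \<alpha> \<delta> C \<and>
                (puiseux_deriv ^^ k) \<phi> \<alpha> = puiseux_const (fact k / (2 * pi * \<i>)) * I))"
      by (intro exI[of _ \<epsilon>] conjI ballI allI impI \<epsilon>) auto
  qed (use higher_derivatives_exist taylor_expansion_disc higher_deriv_mult_bounded in blast)+
qed

end
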